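(* For every $n\ge 6$ there exists no weakly symmetric subspace extension of the permutahedron $\Pi_n$ (with respect to the group $G=S_n$ acting on the vertices by permuting coordinates) with fewer than $\frac{n(n-1)}{2}$ variables; i.e. every weakly symmetric subspace extension $Q\subseteq\mathbb{R}^d$ of $\Pi_n$ satisfies $d\ge\frac{n(n-1)}{2}$.
   Context: The permutahedron $\Pi_n$ is the convex hull of all points of $\mathbb{R}^n$ obtained from $(1,2,\dots,n)$ by permuting coordinates; its vertex set is $X=\{(\zeta^{-1}(1),\dots,\zeta^{-1}(n)) : \zeta\in S_n\}$. The group $S_n$ acts on $\mathbb{R}^n$ by $(\pi.x)_v=x_{\pi^{-1}(v)}$, and $S_d$ acts on $\mathbb{R}^d$ by $(\varkappa.y)_j=y_{\varkappa^{-1}(j)}$. An extension of a polytope $P\subseteq\mathbb{R}^m$ is a polytope $Q\subseteq\mathbb{R}^d$ with a linear map $p:\mathbb{R}^d\to\mathbb{R}^m$ such that $p(Q)=P$; it is a subspace extension if $Q$ is the intersection of an affine subspace of $\mathbb{R}^d$ with the nonnegative orthant $\mathbb{R}^d_+$. A section is a map $s:X\to Q$ with $s(x)\in Q\cap p^{-1}(x)$ for all vertices $x\in X$ of $P$. The extension is weakly symmetric with respect to a group $G\subseteq S_m$ acting on $X$ if there is a section $s:X\to Q$ such that for every $\pi\in G$ there is $\varkappa_\pi\in S_d$ with $s(\pi.x)=\varkappa_\pi.s(x)$ for all $x\in X$. *)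

theory Defs
  imports "HOL-Analysis.Analysis"
begin

text \<open>Vertex set X of the permutahedron Pi_n: all points of R^n whose coordinates
  are a permutation of 1,...,n.  Coordinates are indexed by the finite type 'n,
  n = CARD('n).  A bijection zeta from coordinates to {1..n} gives the vertex
  (zeta v)_v, which is the paper's (zeta^{-1}(1),...,zeta^{-1}(n)) after renaming.\<close>
definition permutahedron_vertices :: "(real ^ 'n::finite) set" where
  "permutahedron_vertices =
     {x. \<exists>\<sigma>::'n \<Rightarrow> nat. bij_betw \<sigma> UNIV {1..CARD('n)} \<and> x = (\<chi> v. real (\<sigma> v))}"

definition permutahedron :: "(real ^ 'n::finite) set" where
  "permutahedron = convex hull permutahedron_vertices"

definition perm_act :: "('i::finite \<Rightarrow> 'i) \<Rightarrow> real ^ 'i \<Rightarrow> real ^ 'i" where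
  "perm_act \<pi> x = (\<chi> v. x $ (inv \<pi> v))"

definition is_extension ::
  "(real ^ 'd::finite) set \<Rightarrow> (real ^ 'd \<Rightarrow> real ^ 'm::finite) \<Rightarrow> (real ^ 'm) set \<Rightarrow> bool" where
  "is_extension Q p P \<longleftrightarrow> polytope Q \<and> linear p \<and> p ` Q = P"

definition is_subspace_extension ::
  "(real ^ 'd::finite) set \<Rightarrow> (real ^ 'd \<Rightarrow> real ^ 'm::finite) \<Rightarrow> (real ^ 'm) set \<Rightarrow> bool" where
  "is_subspace_extension Q p P \<longleftrightarrow> is_extension Q p P \<and>
     (\<exists>A. affine A \<and> Q = A \<inter> {y. \<forall>j. 0 \<le> y $ j})"

definition is_section ::
  "(real ^ 'm::finite \<Rightarrow> real ^ 'd::finite) \<Rightarrow> (real ^ 'd) set \<Rightarrow> (real ^ 'd \<Rightarrow> real ^ 'm)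
     \<Rightarrow> (real ^ 'm) set \<Rightarrow> bool" where
  "is_section s Q p X \<longleftrightarrow> (\<forall>x\<in>X. s x \<in> Q \<and> p (s x) = x)"

definition weakly_symmetric ::
  "(real ^ 'd::finite) set \<Rightarrow> (real ^ 'd \<Rightarrow> real ^ 'm::finite) \<Rightarrow> (real ^ 'm) set
     \<Rightarrow> ('m \<Rightarrow> 'm) set \<Rightarrow> bool" where
  "weakly_symmetric Q p X G \<longleftrightarrow>
     (\<exists>s. is_section s Q p X \<and>
        (\<forall>\<pi>\<in>G. \<exists>\<kappa>::'d \<Rightarrow> 'd. bij \<kappa> \<and>
           (\<forall>x\<in>X. s (perm_act \<pi> x) = perm_act \<kappa> (s x))))"

end

theory Submission
  imports Defs
begin

text \<open>
  Each coordinate \<open>j\<close> of a weakly symmetric section is a function \<open>s\<^sub>j\<close> of the bijection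
  \<open>\<sigma>\<close> that describes a vertex, and the symmetric group permutes these functions. Fix \<open>0 < k < n\<close>
  and a set \<open>S\<close> of \<open>k\<close> coordinates. At a vertex \<open>\<rho>\<close> adjacent to the facet
  \<open>\<sigma>(S) = {1..k}\<close> some \<open>s\<^sub>j\<close> is nonzero although it vanishes on the whole facet: otherwise
  the lifted facet could be pushed across the facet inequality inside \<open>Q\<close>.

  Such an \<open>s\<^sub>j\<close> cannot have a stabiliser that acts transitively on sets of size \<open>k\<close>.
  Orbit counting shows that, with fewer than \<open>n (n - 1) / 2\<close> functions, the stabiliser of
  \<open>s\<^sub>j\<close> then fixes a single point \<open>v\<close> and acts transitively on equal-sized subsets of the
  other points. Hence \<open>s\<^sub>j\<close> depends on \<open>\<sigma>(v)\<close> in such a way that the least value of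
  \<open>\<sigma>(v)\<close> on its support is \<open>k + 1\<close>, or the greatest one is \<open>k\<close>. By symmetry this happens
  for every pair \<open>(k, v)\<close>, while one function serves at most two pairs; so there are at least
  \<open>n (n - 1) / 2\<close> functions.
\<close>

subsection \<open>Symmetric group actions on functions\<close>

text \<open>Precomposing the argument is a right action on maps, so this is a left action on
  functions of maps without any inverse.\<close>

definition act :: "('v \<Rightarrow> 'v) \<Rightarrow> (('v \<Rightarrow> 'b) \<Rightarrow> 'c) \<Rightarrow> ('v \<Rightarrow> 'b) \<Rightarrow> 'c" where
  "act \<pi> f = (\<lambda>\<sigma>. f (\<sigma> \<circ> \<pi>))"

text \<open>Elements of \<open>stab A f\<close> fix every point outside \<open>A\<close>; passing
  from \<open>A\<close> to \<open>A - {a}\<close> therefore means fixing one more point.\<close>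

definition stab :: "'v set \<Rightarrow> (('v \<Rightarrow> 'b) \<Rightarrow> 'c) \<Rightarrow> ('v \<Rightarrow> 'v) set" where
  "stab A f = {\<pi>. \<pi> permutes A \<and> act \<pi> f = f}"

definition orb :: "'v set \<Rightarrow> (('v \<Rightarrow> 'b) \<Rightarrow> 'c) \<Rightarrow> (('v \<Rightarrow> 'b) \<Rightarrow> 'c) set" where
  "orb A f = (\<lambda>\<pi>. act \<pi> f) ` {\<pi>. \<pi> permutes A}"

definition transitive_on :: "'v set \<Rightarrow> (('v \<Rightarrow> 'b) \<Rightarrow> 'c) \<Rightarrow> bool" where
  "transitive_on A f \<longleftrightarrow> (\<forall>x\<in>A. \<forall>y\<in>A. \<exists>u\<in>stab A f. u x = y)"

text \<open>Phrased with sets rather than with the transposition of \<open>x\<close> and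
  \<open>y\<close>: on three or more points an alternating stabiliser satisfies it too, and it still
  yields transitivity on sets of equal size.\<close>

definition exch :: "(('v \<Rightarrow> 'b) \<Rightarrow> 'c) \<Rightarrow> 'v \<Rightarrow> 'v \<Rightarrow> bool" where
  "exch f x y \<longleftrightarrow> (\<forall>T. x \<in> T \<longrightarrow> y \<notin> T \<longrightarrow> (\<exists>u\<in>stab UNIV f. u ` T = insert y (T - {x})))"

lemma act_id [simp]: "act id f = f"
  by (simp add: act_def)

lemma act_comp: "act (\<pi> \<circ> \<rho>) f = act \<pi> (act \<rho> f)"
  by (simp add: act_def comp_assoc)

lemma act_inv_cancel: "bij \<pi> \<Longrightarrow> act (inv \<pi>) (act \<pi> f) = f"
  by (metis act_comp act_id bij_is_inj inv_o_cancel)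

lemma act_inj: "bij \<pi> \<Longrightarrow> act \<pi> f = act \<pi> g \<Longrightarrow> f = g"
  by (metis act_inv_cancel)

lemma stab_comp: "u \<in> stab A f \<Longrightarrow> w \<in> stab A f \<Longrightarrow> u \<circ> w \<in> stab A f"
  by (simp add: stab_def permutes_compose act_comp)

lemma stab_inv: "u \<in> stab A f \<Longrightarrow> inv u \<in> stab A f"
  unfolding stab_def using act_inv_cancel[of u f] permutes_inv permutes_bij by fastforce

lemma stab_id: "id \<in> stab A f"
  by (simp add: stab_def permutes_id)

lemma stab_mono: "A \<subseteq> B \<Longrightarrow> stab A f \<subseteq> stab B f"
  unfolding stab_def using permutes_subset by blast

lemma stab_UNIV: "u \<in> stab A f \<Longrightarrow> u \<in> stab UNIV f"
  using stab_mono[of A UNIV f] by (simp add: subset_iff)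

lemma stab_permutes: "u \<in> stab A f \<Longrightarrow> u permutes A"
  by (simp add: stab_def)

lemma stab_act: "u \<in> stab A f \<Longrightarrow> act u f = f"
  by (simp add: stab_def)

lemma stab_UNIV_iff: "u \<in> stab UNIV f \<longleftrightarrow> bij u \<and> act u f = f"
  by (metis (mono_tags, lifting) UNIV_I bij_imp_permutes mem_Collect_eq permutes_bij stab_def)

lemma transitive_onE:
  assumes "transitive_on A f" "x \<in> A" "y \<in> A"
  obtains u where "u \<in> stab A f" "u x = y"
  using assms(1)[unfolded transitive_on_def, rule_format, OF assms(2,3)] by blast

lemma orb_mono: "A \<subseteq> B \<Longrightarrow> orb A f \<subseteq> orb B f"
  unfolding orb_def using permutes_subset by blast

lemma finite_orb: "finite A \<Longrightarrow> finite (orb A f)"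
  unfolding orb_def by (simp add: finite_permutations)

lemma orb_self: "f \<in> orb A f"
  unfolding orb_def by (rule image_eqI[of _ _ id]) (simp_all add: permutes_id)

lemma transpose_in_orb: "x \<in> A \<Longrightarrow> y \<in> A \<Longrightarrow> act (Transposition.transpose x y) f \<in> orb A f"
  unfolding orb_def by (rule imageI) (simp add: permutes_swap_id)

section \<open>Exchangeability as an equivalence relation invariant under the stabiliser\<close>

lemma exchE:
  assumes "exch f x y" "x \<in> T" "y \<notin> T"
  obtains u where "u \<in> stab UNIV f" "u ` T = insert y (T - {x})"
  using assms(1)[unfolded exch_def, rule_format, OF assms(2,3)] by blast

lemma exch_refl: "exch f x x"
  by (simp add: exch_def)

lemma exch_sym:
  assumes "exch f x y" shows "exch f y x"
proof (cases "x = y")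
  case False
  show ?thesis unfolding exch_def
  proof (intro allI impI)
    fix T assume T: "y \<in> T" "x \<notin> T"
    have "x \<in> insert x (T - {y})" "y \<notin> insert x (T - {y})" using False by auto
    then obtain u where u: "u \<in> stab UNIV f" "u ` (insert x (T - {y})) = insert y (insert x (T - {y}) - {x})"
      by (rule exchE[OF assms])
    have eq: "insert y (insert x (T - {y}) - {x}) = T" using T by auto
    have "inv u ` T = inv u ` (u ` (insert x (T - {y})))" using u(2) eq by simp
    also have "\<dots> = insert x (T - {y})"
      using u(1) by (metis bij_is_inj image_inv_f_f stab_UNIV_iff)
    finally show "\<exists>u\<in>stab UNIV f. u ` T = insert x (T - {y})"
      using stab_inv[OF u(1)] by blast
  qed
qed (simp add: exch_refl)

text \<open>The two exchanges are composed in the order that suits the set: if \<open>y\<close> lies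
  in \<open>T\<close>, first \<open>y\<close> gives way to \<open>z\<close> and then
  \<open>x\<close> to \<open>y\<close>; otherwise \<open>x\<close> gives way to \<open>y\<close>
  first.\<close>

lemma exch_trans:
  assumes xy: "exch f x y" and yz: "exch f y z" shows "exch f x z"
proof (cases "x = y \<or> y = z \<or> x = z")
  case False
  show ?thesis unfolding exch_def
  proof (intro allI impI)
    fix T assume T: "x \<in> T" "z \<notin> T"
    show "\<exists>u\<in>stab UNIV f. u ` T = insert z (T - {x})"
    proof (cases "y \<in> T")
      case True
      obtain u where u: "u \<in> stab UNIV f" "u ` T = insert z (T - {y})"
        by (rule exchE[OF yz True T(2)])
      have "x \<in> insert z (T - {y})" "y \<notin> insert z (T - {y})" using False T by auto
      then obtain w where w: "w \<in> stab UNIV f" "w ` insert z (T - {y}) = insert y (insert z (T - {y}) - {x})"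
        by (rule exchE[OF xy])
      have "(w \<circ> u) ` T = insert y (insert z (T - {y}) - {x})"
        unfolding image_comp[symmetric] u(2) w(2) ..
      also have "\<dots> = insert z (T - {x})" using True False by auto
      finally show ?thesis using stab_comp[OF w(1) u(1)] by blast
    next
      case nT: False
      obtain u where u: "u \<in> stab UNIV f" "u ` T = insert y (T - {x})"
        by (rule exchE[OF xy T(1) nT])
      have "y \<in> insert y (T - {x})" "z \<notin> insert y (T - {x})" using False T by auto
      then obtain w where w: "w \<in> stab UNIV f" "w ` insert y (T - {x}) = insert z (insert y (T - {x}) - {y})"
        by (rule exchE[OF yz])
      have "(w \<circ> u) ` T = insert z (insert y (T - {x}) - {y})"
        unfolding image_comp[symmetric] u(2) w(2) ..
      also have "\<dots> = insert z (T - {x})" using nT False by auto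
      finally show ?thesis using stab_comp[OF w(1) u(1)] by blast
    qed
  qed
qed (use assms exch_refl in auto)

text \<open>Conjugating the exchanging elements by \<open>u\<close> transports the relation.\<close>

lemma exch_stab:
  assumes "exch f x y" and u: "u \<in> stab UNIV f" shows "exch f (u x) (u y)"
  unfolding exch_def
proof (intro allI impI)
  fix T assume T: "u x \<in> T" "u y \<notin> T"
  have b: "bij u" using u by (simp add: stab_UNIV_iff)
  have "x \<in> inv u ` T" using T(1) b by (metis bij_is_inj image_eqI inv_f_f)
  moreover have "y \<notin> inv u ` T" using T(2) b by (metis bij_is_surj imageE surj_f_inv_f)
  ultimately obtain w where w: "w \<in> stab UNIV f" "w ` inv u ` T = insert y (inv u ` T - {x})"
    by (rule exchE[OF assms(1)])
  have "(u \<circ> (w \<circ> inv u)) ` T = u ` insert y (inv u ` T - {x})"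
    by (simp only: image_comp[symmetric] w(2))
  also have "\<dots> = insert (u y) (u ` inv u ` T - {u x})"
    using b by (simp add: image_set_diff bij_is_inj)
  also have "u ` inv u ` T = T"
    using b by (simp add: bij_is_surj image_f_inv_f)
  finally show "\<exists>u'\<in>stab UNIV f. u' ` T = insert (u y) (T - {u x})"
    using stab_comp[OF u stab_comp[OF w(1) stab_inv[OF u]]] by blast
qed

text \<open>The hypothesis says that a transposition or a 3-cycle fixes \<open>f\<close>.\<close>

lemma exch_if_transpose_eq:
  assumes eq: "act (Transposition.transpose z x) f = act (Transposition.transpose z y) f"
  shows "exch f x y"
proof (cases "x = y")
  case False
  \<comment> \<open>These are mutually inverse. For distinct points \<open>r\<close> sends
    \<open>x\<close> to \<open>z\<close> and \<open>z\<close> to \<open>y\<close>, which serves sets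
    containing \<open>z\<close>, while \<open>r'\<close> sends \<open>x\<close> directly to
    \<open>y\<close>, which serves the others.\<close>
  define r where "r = Transposition.transpose z x \<circ> Transposition.transpose z y"
  define r' where "r' = Transposition.transpose z y \<circ> Transposition.transpose z x"
  have inv: "act (Transposition.transpose z w) (act (Transposition.transpose z w) f) = f" for w
    by (simp add: act_comp[symmetric])
  have r: "r \<in> stab UNIV f" unfolding r_def stab_UNIV_iff
    using inv by (simp add: act_comp eq[symmetric] bij_comp)
  have r': "r' \<in> stab UNIV f" unfolding r'_def stab_UNIV_iff
    using inv by (simp add: act_comp eq bij_comp)
  show ?thesis unfolding exch_def
  proof (intro allI impI)
    fix T assume T: "x \<in> T" "y \<notin> T"
    have fix_r: "r ` (T - {x,z}) = T - {x,z}" "r' ` (T - {x,z}) = T - {x,z}"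
    proof -
      have "r w = w \<and> r' w = w" if "w \<in> T - {x,z}" for w
      proof -
        have "w \<noteq> x" "w \<noteq> y" "w \<noteq> z" using that T by auto
        then show ?thesis by (simp add: r_def r'_def)
      qed
      then show "r ` (T - {x,z}) = T - {x,z}" "r' ` (T - {x,z}) = T - {x,z}" by simp_all
    qed
    show "\<exists>u\<in>stab UNIV f. u ` T = insert y (T - {x})"
    proof (cases "z \<in> T")
      case True
      show ?thesis
      proof (cases "z = x")
        case True
        have "T = insert x (T - {x,z})" using T True by auto
        then have "r ` T = r ` insert x (T - {x,z})" by (rule arg_cong)
        also have "\<dots> = insert (r x) (T - {x,z})" by (simp only: image_insert fix_r)
        also have "r x = y" using True by (simp add: r_def)
        finally show ?thesis using r True by auto
      next
        case nz: False
        have "T = insert x (insert z (T - {x,z}))" using T True by auto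
        then have "r ` T = r ` insert x (insert z (T - {x,z}))" by (rule arg_cong)
        also have "\<dots> = insert (r x) (insert (r z) (T - {x,z}))" by (simp only: image_insert fix_r)
        also have "r x = z" using nz False T by (simp add: r_def Transposition.transpose_def)
        also have "r z = y" using nz False T True by (auto simp: r_def Transposition.transpose_def)
        also have "insert z (insert y (T - {x,z})) = insert y (T - {x})" using True nz by auto
        finally show ?thesis using r by blast
      qed
    next
      case nz: False
      have "T = insert x (T - {x,z})" using T nz by auto
      then have "r' ` T = r' ` insert x (T - {x,z})" by (rule arg_cong)
        also have "\<dots> = insert (r' x) (T - {x,z})" by (simp only: image_insert fix_r)
      also have "r' x = y" by (simp add: r'_def)
      also have "T - {x,z} = T - {x}" using nz by auto
      finally show ?thesis using r' by blast
    qed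
  qed
qed (simp add: exch_refl)

lemma exch_imp_ex_stab: 
  assumes "exch f x y" shows "\<exists>u\<in>stab UNIV f. u x = y"
proof (cases "x = y")
  case True then show ?thesis using stab_id[of UNIV f] by (auto intro: bexI[of _ id])
next
  case False
  then have "x \<in> {x}" "y \<notin> {x}" by auto
  then obtain u where "u \<in> stab UNIV f" "u ` {x} = insert y ({x} - {x})"
    by (rule exchE[OF assms])
  then show ?thesis by auto
qed

text \<open>Points of \<open>S - S'\<close> are traded one at a time for points of
  \<open>S' - S\<close>. Only the difference has to lie in \<open>W\<close>, so both sets may share
  a point outside \<open>W\<close>.\<close>

lemma homogeneous_of_exch:
  fixes S S' :: "'v::finite set"
  assumes ex: "\<And>x y. x \<in> W \<Longrightarrow> y \<in> W \<Longrightarrow> exch f x y"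
    and "S - S' \<subseteq> W" "S' - S \<subseteq> W" "card S = card S'"
  shows "\<exists>u\<in>stab UNIV f. u ` S = S'"
  using assms(2-)
proof (induction "card (S - S')" arbitrary: S)
  case 0
  then have "S \<subseteq> S'" by simp
  then have "S = S'" using 0 by (simp add: card_subset_eq)
  then show ?case using stab_id[of UNIV f] by (metis image_id id_apply)
next
  case (Suc m)
  then obtain x where x: "x \<in> S" "x \<notin> S'" by (metis Diff_eq_empty_iff card.empty nat.distinct(1) subsetI)
  have "card (S' - S) = card (S - S')"
    using Suc.prems(3) by (metis Int_commute card_Diff_subset_Int finite)
  then obtain y where y: "y \<in> S'" "y \<notin> S" using Suc.hyps(2)
    by (metis Diff_eq_empty_iff card.empty nat.distinct(1) subsetI)
  have "exch f x y" using ex x y Suc.prems by blast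
  then obtain u where u: "u \<in> stab UNIV f" "u ` S = insert y (S - {x})"
    by (rule exchE[OF _ x(1) y(2)])
  let ?S = "insert y (S - {x})"
  have d: "?S - S' = (S - S') - {x}" using x y by auto
  have "m = card (?S - S')" unfolding d using Suc.hyps(2) x by simp
  moreover have "?S - S' \<subseteq> W" "S' - ?S \<subseteq> W" using Suc.prems x y by auto
  moreover have "card ?S = card S'"
    using Suc.prems(3) x(1) y(2) card_Suc_Diff1[of S x] by (metis Diff_iff card_insert_disjoint finite)
  ultimately obtain w where "w \<in> stab UNIV f" "w ` ?S = S'" using Suc.hyps(1) by blast
  then show ?case using stab_comp[of w UNIV f u] u by (metis image_comp)
qed

text \<open>Double counting of the orbit of \<open>(f, a)\<close> under the symmetric group of \<open>A\<close>.\<close>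

lemma card_orb_remove:
  fixes f :: "('v::finite \<Rightarrow> 'b) \<Rightarrow> 'c"
  assumes a: "a \<in> A"
  shows "card (orb A f) * card ((\<lambda>u. u a) ` stab A f) = card A * card (orb (A - {a}) f)"
proof -
  define P where "P = (\<lambda>\<pi>. (act \<pi> f, \<pi> a)) ` {\<pi>. \<pi> permutes A}"
  have fin: "finite P" unfolding P_def by (simp add: finite_permutations)
  have P1: "P = Sigma (orb A f) (\<lambda>g. {x. (g, x) \<in> P})"
    unfolding P_def orb_def by auto
  have P2: "prod.swap ` P = Sigma A (\<lambda>x. {g. (g, x) \<in> P})"
  proof -
    have "x \<in> A" if "(g, x) \<in> P" for g x
      using that a unfolding P_def by (auto simp: permutes_in_image)
    then show ?thesis by (force simp: image_iff prod.swap_def)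
  qed
  \<comment> \<open>The points paired with \<open>act \<rho> f\<close> are the image under
    \<open>\<rho>\<close> of the stabiliser orbit of \<open>a\<close>.\<close>
  have f1: "card {x. (g, x) \<in> P} = card ((\<lambda>u. u a) ` stab A f)" if g: "g \<in> orb A f" for g
  proof -
    obtain \<rho> where \<rho>: "\<rho> permutes A" "g = act \<rho> f" using g unfolding orb_def by blast
    have b: "bij \<rho>" using \<rho> by (simp add: permutes_bij)
    have "{x. (g, x) \<in> P} = \<rho> ` ((\<lambda>u. u a) ` stab A f)"
    proof (intro set_eqI iffI)
      fix x assume "x \<in> {x. (g, x) \<in> P}"
      then obtain \<pi> where \<pi>: "\<pi> permutes A" "act \<pi> f = act \<rho> f" "x = \<pi> a"
        unfolding P_def \<rho> by auto
      have "inv \<rho> \<circ> \<pi> \<in> stab A f"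
        using \<pi> \<rho> b by (simp add: stab_def permutes_compose permutes_inv act_comp act_inv_cancel)
      moreover have "x = \<rho> ((inv \<rho> \<circ> \<pi>) a)" using \<pi> b by (simp add: bij_is_surj surj_f_inv_f)
      ultimately show "x \<in> \<rho> ` ((\<lambda>u. u a) ` stab A f)" by blast
    next
      fix x assume "x \<in> \<rho> ` ((\<lambda>u. u a) ` stab A f)"
      then obtain u where u: "u \<in> stab A f" "x = (\<rho> \<circ> u) a" by auto
      then have "\<rho> \<circ> u permutes A" "act (\<rho> \<circ> u) f = g"
        using \<rho> by (simp_all add: stab_def permutes_compose act_comp)
      then show "x \<in> {x. (g, x) \<in> P}" unfolding P_def using u by (auto intro!: image_eqI)
    qed
    then show ?thesis using b by (simp add: card_image inj_on_subset[OF bij_is_inj])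
  qed
  \<comment> \<open>The permutations taking \<open>a\<close> to \<open>x\<close> form the coset, by
    one such \<open>\<rho>\<close>, of those that fix \<open>a\<close>.\<close>
  have f2: "card {g. (g, x) \<in> P} = card (orb (A - {a}) f)" if x: "x \<in> A" for x
  proof -
    define \<rho> where "\<rho> = Transposition.transpose a x"
    have \<rho>: "\<rho> permutes A" "\<rho> a = x" "bij \<rho>"
      using x a by (simp_all add: \<rho>_def permutes_swap_id)
    have "{g. (g, x) \<in> P} = act \<rho> ` orb (A - {a}) f"
    proof (intro set_eqI iffI)
      fix g assume "g \<in> {g. (g, x) \<in> P}"
      then obtain \<pi> where \<pi>: "\<pi> permutes A" "g = act \<pi> f" "x = \<pi> a" unfolding P_def by auto
      define q where "q = inv \<rho> \<circ> \<pi>"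
      have "q permutes A" using \<pi> \<rho> by (simp add: q_def permutes_compose permutes_inv)
      moreover have "q a = a" using \<pi> \<rho> by (metis bij_is_inj comp_apply inv_f_f q_def)
      ultimately have "q permutes A - {a}" by (auto simp: permutes_def)
      moreover have "g = act \<rho> (act q f)"
        using \<pi> \<rho> by (metis act_comp bij_is_surj comp_assoc id_comp q_def surj_iff)
      ultimately show "g \<in> act \<rho> ` orb (A - {a}) f" unfolding orb_def by blast
    next
      fix g assume "g \<in> act \<rho> ` orb (A - {a}) f"
      then obtain q where q: "q permutes A - {a}" "g = act (\<rho> \<circ> q) f"
        unfolding orb_def by (auto simp: act_comp)
      have "q permutes A" using q by (meson Diff_subset permutes_subset)
      moreover have "q a = a" using q by (meson Diff_iff insertI1 permutes_not_in)
      ultimately have "\<rho> \<circ> q permutes A" "(\<rho> \<circ> q) a = x"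
        using \<rho> by (simp_all add: permutes_compose)
      then show "g \<in> {g. (g, x) \<in> P}" unfolding P_def using q by force
    qed
    moreover have "inj (act \<rho> :: (('v \<Rightarrow> 'b) \<Rightarrow> 'c) \<Rightarrow> _)" using act_inj[OF \<rho>(3)] by (meson injI)
    ultimately show ?thesis by (simp add: card_image inj_on_subset)
  qed
  have "card P = (\<Sum>g\<in>orb A f. card {x. (g, x) \<in> P})"
    by (subst P1, rule card_SigmaI) (simp_all add: finite_orb)
  then have c1: "card P = card (orb A f) * card ((\<lambda>u. u a) ` stab A f)" using f1 by simp
  have fg: "finite {g. (g, x) \<in> P}" for x
    by (rule finite_subset[OF _ finite_imageI[OF fin, of fst]]) (force intro: rev_image_eqI)
  have "card P = card (prod.swap ` P)" by (simp add: card_image)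
  also have "\<dots> = (\<Sum>x\<in>A. card {g. (g, x) \<in> P})"
    by (subst P2, rule card_SigmaI) (simp_all add: fg)
  finally show ?thesis using c1 f2 by simp
qed

text \<open>The stabiliser orbit of \<open>a\<close> is all of \<open>A\<close>, so
  \<open>card A\<close> cancels in the double count.\<close>

lemma card_orb_trans:
  fixes f :: "('v::finite \<Rightarrow> 'b) \<Rightarrow> 'c"
  assumes "a \<in> A" "transitive_on A f"
  shows "card (orb (A - {a}) f) = card (orb A f)"
proof -
  have "(\<lambda>u. u a) ` stab A f = A"
  proof (intro equalityI subsetI)
    fix x assume "x \<in> A"
    then show "x \<in> (\<lambda>u. u a) ` stab A f" using assms unfolding transitive_on_def by (metis image_eqI)
  qed (use assms(1) in \<open>auto simp: stab_def permutes_in_image\<close>)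
  moreover have "card A > 0" using assms by (auto simp: card_gt_0_iff)
  ultimately show ?thesis using card_orb_remove[OF assms(1), of f] by auto
qed

text \<open>The opposite extreme of the double count: the stabiliser orbit of \<open>a\<close> is a
  single point.\<close>

lemma card_orb_fixed:
  fixes f :: "('v::finite \<Rightarrow> 'b) \<Rightarrow> 'c"
  assumes "a \<in> A" "\<And>u. u \<in> stab A f \<Longrightarrow> u a = a"
  shows "card (orb A f) = card A * card (orb (A - {a}) f)"
proof -
  have "(\<lambda>u. u a) ` stab A f = {a}"
  proof (intro equalityI subsetI)
    fix x assume "x \<in> {a}"
    then show "x \<in> (\<lambda>u. u a) ` stab A f" using stab_id[of A f] by (intro image_eqI[of _ _ id]) simp_all
  qed (use assms(2) in auto)
  then show ?thesis using card_orb_remove[OF assms(1), of f] by simp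
qed

text \<open>Sending \<open>act \<pi> f\<close> to the image of \<open>I\<close> under
  \<open>\<pi>\<close> maps the orbit onto all subsets of \<open>A\<close> of size
  \<open>card I\<close>.\<close>

lemma binomial_le_card_orb:
  fixes f :: "('v::finite \<Rightarrow> 'b) \<Rightarrow> 'c"
  assumes I: "I \<subseteq> A" "\<And>u. u \<in> stab A f \<Longrightarrow> u ` I = I"
  shows "card A choose card I \<le> card (orb A f)"
proof -
  \<comment> \<open>The choice of \<open>\<pi>\<close> is immaterial: two choices differ by an
    element of the stabiliser, and these preserve \<open>I\<close>.\<close>
  define h where "h = (\<lambda>g. (SOME \<pi>. \<pi> permutes A \<and> act \<pi> f = g) ` I)"
  have h: "h (act \<pi> f) = \<pi> ` I" if \<pi>: "\<pi> permutes A" for \<pi>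
  proof -
    define \<rho> where "\<rho> = (SOME \<rho>. \<rho> permutes A \<and> act \<rho> f = act \<pi> f)"
    have \<rho>: "\<rho> permutes A" "act \<rho> f = act \<pi> f"
      unfolding \<rho>_def using \<pi> by (metis (mono_tags, lifting) someI)+
    have "inv \<rho> \<circ> \<pi> \<in> stab A f"
      unfolding stab_def using \<pi> \<rho>(1) act_inv_cancel[of \<rho> f] permutes_bij[OF \<rho>(1)]
      by (simp add: permutes_compose permutes_inv act_comp \<rho>(2)[symmetric])
    then have "(inv \<rho> \<circ> \<pi>) ` I = I" by (rule I)
    then have "\<rho> ` I = \<rho> ` inv \<rho> ` \<pi> ` I" by (simp add: image_comp)
    also have "\<dots> = \<pi> ` I" using permutes_bij[OF \<rho>(1)] by (simp add: bij_is_surj image_f_inv_f)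
    finally show ?thesis by (simp add: h_def \<rho>_def)
  qed
  have "{T. T \<subseteq> A \<and> card T = card I} \<subseteq> h ` orb A f"
  proof
    fix T assume T: "T \<in> {T. T \<subseteq> A \<and> card T = card I}"
    have "\<exists>\<pi>. \<pi> permutes A \<and> \<pi> ` I = T"
    proof -
      obtain b1 where b1: "bij_betw b1 I T" using T by (metis (mono_tags, lifting) finite finite_same_card_bij mem_Collect_eq)
      have "card (A - I) = card (A - T)" using T I(1) by (simp add: card_Diff_subset)
      then obtain b2 where b2: "bij_betw b2 (A - I) (A - T)" by (metis finite finite_same_card_bij)
      define \<pi> where "\<pi> = (\<lambda>x. if x \<in> I then b1 x else if x \<in> A then b2 x else x)"
      have "bij_betw \<pi> I T" using b1 by (simp add: \<pi>_def cong: bij_betw_cong)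
      moreover have "bij_betw \<pi> (A - I) (A - T)"
        using b2 by (subst bij_betw_cong[of _ _ b2]) (auto simp: \<pi>_def)
      ultimately have "bij_betw \<pi> (I \<union> (A - I)) (T \<union> (A - T))"
        by (rule bij_betw_combine) auto
      then have "bij_betw \<pi> A A" using I(1) T by (simp add: Un_absorb1)
      then have "\<pi> permutes A" using I(1) by (intro bij_imp_permutes) (auto simp: \<pi>_def)
      then show ?thesis using \<open>bij_betw \<pi> I T\<close> bij_betw_imp_surj_on by blast
    qed
    then show "T \<in> h ` orb A f" using h unfolding orb_def by force
  qed
  then have "card {T. T \<subseteq> A \<and> card T = card I} \<le> card (orb A f)"
    by (meson finite card_image_le card_mono finite_imageI finite_orb le_trans)
  then show ?thesis by (simp add: n_subsets)
qed

text \<open>Pigeonhole on the transpositions of a fixed \<open>z\<close> with each point of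
  \<open>Z\<close>, the identity being the one for \<open>z\<close> itself.\<close>

lemma exch_of_small_orb:
  fixes f :: "('v::finite \<Rightarrow> 'b) \<Rightarrow> 'c"
  assumes "card (orb Z f) < card Z"
  obtains x y where "x \<in> Z" "y \<in> Z" "x \<noteq> y" "exch f x y"
proof -
  obtain z where z: "z \<in> Z" using assms by fastforce
  have "(\<lambda>x. act (Transposition.transpose z x) f) ` Z \<subseteq> orb Z f"
    using z by (auto intro: transpose_in_orb)
  then have "\<not> inj_on (\<lambda>x. act (Transposition.transpose z x) f) Z"
    using assms by (metis card_image card_mono finite finite_orb not_le)
  then show thesis using that exch_if_transpose_eq unfolding inj_on_def by metis
qed

text \<open>A stabiliser orbit that misses some point of \<open>A\<close> serves as
  \<open>I\<close>.\<close>

lemma not_transitive_invariant: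
  assumes "\<not> transitive_on A f"
  obtains I where "I \<subset> A" "I \<noteq> {}" "\<And>u. u \<in> stab A f \<Longrightarrow> u ` I = I"
proof -
  obtain x y where xy: "x \<in> A" "y \<in> A" "\<And>u. u \<in> stab A f \<Longrightarrow> u x \<noteq> y"
    using assms unfolding transitive_on_def by blast
  define I where "I = (\<lambda>u. u x) ` stab A f"
  have "I \<subseteq> A" using xy(1) by (auto simp: I_def stab_def permutes_in_image)
  moreover have "y \<notin> I" using xy(3) by (auto simp: I_def)
  moreover have "x \<in> I" unfolding I_def using stab_id[of A f] by (intro image_eqI[of _ _ id]) auto
  moreover have "u ` I = I" if u: "u \<in> stab A f" for u
  proof (intro equalityI subsetI)
    fix w assume "w \<in> u ` I"
    then obtain v where "v \<in> stab A f" "w = (u \<circ> v) x" by (auto simp: I_def)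
    then show "w \<in> I" unfolding I_def using stab_comp[OF u] by blast
  next
    fix w assume "w \<in> I"
    then obtain v where v: "v \<in> stab A f" "w = v x" by (auto simp: I_def)
    have "(inv u \<circ> v) x \<in> I" unfolding I_def using stab_comp[OF stab_inv[OF u] v(1)] by blast
    moreover have "w = u ((inv u \<circ> v) x)"
      using v(2) stab_permutes[OF u] by (simp add: permutes_inverses)
    ultimately show "w \<in> u ` I" by blast
  qed
  ultimately show thesis using that[of I] xy(2) by blast
qed

section \<open>Transitivity and exchangeability forced by small orbits\<close>

lemma binomial_ge_binomial:
  assumes "j \<le> i" "i + j \<le> n" "2 * j \<le> n"
  shows "n choose j \<le> n choose i"
proof (cases "2 * i \<le> n")
  case True
  then show ?thesis using assms by (intro binomial_mono) auto
next
  case False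
  then have "n choose j \<le> n choose (n - i)" using assms by (intro binomial_mono) auto
  then show ?thesis using binomial_symmetric[of i n] assms by simp
qed

lemma card_le_card_orb:
  fixes f :: "('v::finite \<Rightarrow> 'b) \<Rightarrow> 'c"
  assumes "\<not> transitive_on A f"
  shows "card A \<le> card (orb A f)"
proof -
  obtain I where I: "I \<subset> A" "I \<noteq> {}" "\<And>u. u \<in> stab A f \<Longrightarrow> u ` I = I"
    using not_transitive_invariant[OF assms] by blast
  have "card I < card A" using I by (simp add: psubset_card_mono)
  moreover have "card I > 0" using I by (simp add: card_gt_0_iff)
  ultimately have "card A choose 1 \<le> card A choose card I"
    by (intro binomial_ge_binomial) auto
  then show ?thesis using binomial_le_card_orb[where f = f, OF psubset_imp_subset[OF I(1)] I(3)] by simp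
qed

text \<open>An invariant set with at least two points inside and two outside would force an orbit of
  size \<open>card A choose 2\<close>. Hence an invariant set or its complement in \<open>A\<close>
  is a single point.\<close>

lemma fixed_point_of_small_orb:
  fixes f :: "('v::finite \<Rightarrow> 'b) \<Rightarrow> 'c"
  assumes "\<not> transitive_on A f" and small: "card (orb A f) < card A choose 2"
  obtains v where "v \<in> A" "\<And>u. u \<in> stab A f \<Longrightarrow> u v = v"
proof -
  obtain I where I: "I \<subset> A" "I \<noteq> {}" "\<And>u. u \<in> stab A f \<Longrightarrow> u ` I = I"
    using not_transitive_invariant[OF assms(1)] by blast
  have lt: "card I < card A" using I by (simp add: psubset_card_mono)
  have gt: "card I > 0" using I by (simp add: card_gt_0_iff)
  have le: "card A choose card I \<le> card (orb A f)" using binomial_le_card_orb[where f = f, OF psubset_imp_subset[OF I(1)] I(3)] by simp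
  have "\<not> (2 \<le> card I \<and> card I + 2 \<le> card A)"
    using binomial_ge_binomial[of 2 "card I" "card A"] le small by linarith
  then consider "card I = 1" | "card (A - I) = 1"
    using lt gt I(1) by (fastforce simp: card_Diff_subset)
  then show thesis
  proof cases
    case 1
    then obtain v where "I = {v}" by (meson card_1_singletonE)
    then show thesis using that[of v] I by auto
  next
    case 2
    then obtain v where v: "A - I = {v}" by (meson card_1_singletonE)
    have "u v = v" if u: "u \<in> stab A f" for u
    proof -
      have "u ` (A - I) = A - I"
        using stab_permutes[OF u] I(3)[OF u] by (simp add: image_set_diff permutes_inj permutes_image)
      then show ?thesis using v by simp
    qed
    then show thesis using that[of v] v by blast
  qed
qed

text \<open>Stabiliser elements that fix \<open>x\<close> carry the pair \<open>(x, y)\<close> to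
  \<open>(x, w)\<close> for every other \<open>w\<close>; the equivalence relation then has one
  class on \<open>A\<close>.\<close>

lemma exch_all_of_transitive:
  assumes "exch f x y" "x \<noteq> y" "x \<in> A" "y \<in> A" "transitive_on (A - {x}) f"
    and "p \<in> A" "q \<in> A"
  shows "exch f p q"
proof -
  have x: "exch f x w" if w: "w \<in> A" for w
  proof (cases "w = x")
    case False
    then obtain u where u: "u \<in> stab (A - {x}) f" "u y = w"
      using w transitive_onE[OF assms(5), of y w] assms by blast
    have "u x = x" using stab_permutes[OF u(1)] by (simp add: permutes_def)
    moreover have "u \<in> stab UNIV f" using u(1) by (rule stab_UNIV)
    ultimately show ?thesis using exch_stab[OF assms(1), of u] u(2) by simp
  qed (simp add: exch_refl)
  show ?thesis by (rule exch_trans[OF exch_sym[OF x[OF assms(6)]] x[OF assms(7)]])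
qed

lemma exch_all_of_small_orb:
  fixes f :: "('v::finite \<Rightarrow> 'b) \<Rightarrow> 'c"
  assumes "2 * card (orb A f) < card A" "p \<in> A" "q \<in> A"
  shows "exch f p q"
proof -
  have pos: "0 < card (orb A f)" using orb_self[of f A] finite_orb[of A f] by (auto simp: card_gt_0_iff)
  have tr: "transitive_on A f" using card_le_card_orb[of A f] assms by linarith
  have "card (orb A f) < card A" using assms by linarith
  then obtain x y where xy: "x \<in> A" "y \<in> A" "x \<noteq> y" "exch f x y" by (rule exch_of_small_orb)
  have "card (orb (A - {x}) f) = card (orb A f)" using card_orb_trans[OF xy(1) tr] .
  moreover have "card (A - {x}) = card A - 1" using xy by simp
  \<comment> \<open>Since the orbit is nonempty, being below half of \<open>card A\<close> also
    makes it smaller than \<open>card A - 1\<close>.\<close>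
  ultimately have "transitive_on (A - {x}) f"
    using card_le_card_orb[of "A - {x}" f] assms pos by linarith
  then show ?thesis using exch_all_of_transitive[OF xy(4,3,1,2)] assms by blast
qed

text \<open>The fixed point \<open>v\<close> contributes a factor \<open>CARD('v)\<close> to the
  orbit size. What remains is below half the number of other points, so these are all
  exchangeable.\<close>

lemma intransitive_small_orb:
  fixes f :: "('v::finite \<Rightarrow> 'b) \<Rightarrow> 'c"
  assumes small: "2 * card (orb UNIV f) < CARD('v) * (CARD('v) - 1)"
    and "\<not> transitive_on UNIV f"
  obtains v where "\<And>u. u \<in> stab UNIV f \<Longrightarrow> u v = v"
    and "\<And>x y. x \<noteq> v \<Longrightarrow> y \<noteq> v \<Longrightarrow> exch f x y"
proof -
  have "2 * (CARD('v) choose 2) = CARD('v) * (CARD('v) - 1)" by (simp add: choose_two)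
  then have "card (orb UNIV f) < CARD('v) choose 2" using small by linarith
  then obtain v where v: "\<And>u. u \<in> stab UNIV f \<Longrightarrow> u v = v"
    using fixed_point_of_small_orb[OF assms(2)] by blast
  have "card (orb UNIV f) = CARD('v) * card (orb (UNIV - {v}) f)"
    using card_orb_fixed[of v UNIV f] v by simp
  then have "CARD('v) * (2 * card (orb (UNIV - {v}) f)) < CARD('v) * (CARD('v) - 1)"
    using small by (simp add: mult.left_commute)
  then have "2 * card (orb (UNIV - {v}) f) < card (UNIV - {v})"
    by (simp add: card_Diff_singleton)
  then have "exch f x y" if "x \<noteq> v" "y \<noteq> v" for x y
    using exch_all_of_small_orb[of "UNIV - {v}" f x y] that by blast
  then show thesis using that v by blast
qed

text \<open>The identity, the three transpositions of \<open>x\<close>, \<open>y\<close>,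
  \<open>z\<close> and a 3-cycle give distinct functions, because any coincidence would make two
  distinct points exchangeable.\<close>

lemma five_le_card_orb:
  fixes f :: "('v::finite \<Rightarrow> 'b) \<Rightarrow> 'c"
  assumes Z: "x \<in> Z" "y \<in> Z" "z \<in> Z" and d: "x \<noteq> y" "x \<noteq> z" "y \<noteq> z"
    and no: "\<And>p q. exch f p q \<Longrightarrow> p = q"
  shows "5 \<le> card (orb Z f)"
proof -
  let ?t = Transposition.transpose
  have ne1: "act (?t p q) f \<noteq> f" if "p \<noteq> q" for p q
    using no[OF exch_if_transpose_eq[of p q f p]] that by fastforce
  have ne2: "act (?t p q) f \<noteq> act (?t p r) f" if "q \<noteq> r" for p q r
    using no[OF exch_if_transpose_eq[of p q f r]] that by blast
  let ?r = "act (?t x y) (act (?t y z) f)"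
  \<comment> \<open>The same 3-cycle is written with each of the three transpositions in front, so
    that each can be cancelled when the 3-cycle is compared with it.\<close>
  have r2: "?r = act (?t y z) (act (?t x z) f)"
    unfolding act_comp[symmetric] by (rule arg_cong[of _ _ "\<lambda>p. act p f"])
      (use d in \<open>auto simp: fun_eq_iff Transposition.transpose_def\<close>)
  have r3: "?r = act (?t x z) (act (?t x y) f)"
    unfolding act_comp[symmetric] by (rule arg_cong[of _ _ "\<lambda>p. act p f"])
      (use d in \<open>auto simp: fun_eq_iff Transposition.transpose_def\<close>)
  have b: "bij (?t p q)" for p q :: 'v by simp
  have n1: "?r \<noteq> act (?t x y) f" using act_inj[OF b] ne1[of y z] d by blast
  have n2: "?r \<noteq> act (?t y z) f" unfolding r2 using act_inj[OF b] ne1[of x z] d by blast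
  have n3: "?r \<noteq> act (?t x z) f" unfolding r3 using act_inj[OF b] ne1[of x y] d by blast
  have n4: "?r \<noteq> f"
  proof
    assume "?r = f"
    moreover have "act (?t x y) (act (?t x y) f) = f" by (simp add: act_comp[symmetric])
    ultimately have "act (?t y z) f = act (?t x y) f" using act_inj[OF b] by metis
    then show False using ne2[of z x y] d by (metis ne2 transpose_commute)
  qed
  have n5: "act (?t x y) f \<noteq> act (?t y z) f" using ne2[of x z y] d by (simp add: transpose_commute[of x y])
  have n6: "act (?t x z) f \<noteq> act (?t y z) f"
    using ne2[of x y z] d by (simp add: transpose_commute[of _ z])
  have "distinct [f, act (?t x y) f, act (?t x z) f, act (?t y z) f, ?r]"
    using n1 n2 n3 n4 n5 n6 ne1 ne2 d by (simp, metis)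
  then have "card (set [f, act (?t x y) f, act (?t x z) f, act (?t y z) f, ?r]) = 5"
    by (simp only: distinct_card) simp
  moreover have "?r \<in> orb Z f"
    unfolding orb_def act_comp[symmetric] using Z
    by (intro imageI CollectI permutes_compose permutes_swap_id)
  then have "set [f, act (?t x y) f, act (?t x z) f, act (?t y z) f, ?r] \<subseteq> orb Z f"
    using Z by (simp add: orb_self transpose_in_orb)
  ultimately show ?thesis using card_mono[OF finite_orb[of Z f]] by (metis finite)
qed

text \<open>Pigeonhole over all two-element sets; the colliding pairs may overlap or be
  disjoint.\<close>

lemma transpose_pair_collision:
  fixes f :: "('v::finite \<Rightarrow> 'b) \<Rightarrow> 'c"
  assumes "card (orb UNIV f) < CARD('v) choose 2"
  obtains a b c d where "a \<noteq> b" "c \<noteq> d" "{a, b} \<noteq> {c, d}"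
    "act (Transposition.transpose a b) f = act (Transposition.transpose c d) f"
proof -
  define E where "E = {e :: 'v set. e \<subseteq> UNIV \<and> card e = 2}"
  have "\<forall>e\<in>E. \<exists>t. \<exists>a b. e = {a, b} \<and> a \<noteq> b \<and> t = Transposition.transpose a b"
    unfolding E_def by (auto simp: card_2_iff)
  from bchoice[OF this] obtain t where
    t: "\<forall>e\<in>E. \<exists>a b. e = {a, b} \<and> a \<noteq> b \<and> t e = Transposition.transpose a b" ..
  have "(\<lambda>e. act (t e) f) ` E \<subseteq> orb UNIV f"
  proof (intro image_subsetI)
    fix e assume "e \<in> E"
    from bspec[OF t this] obtain a b where "t e = Transposition.transpose a b" by (elim exE conjE)
    then show "act (t e) f \<in> orb UNIV f" by (simp add: transpose_in_orb)
  qed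
  moreover have "card E = CARD('v) choose 2" unfolding E_def by (rule n_subsets) simp
  ultimately have "\<not> inj_on (\<lambda>e. act (t e) f) E"
    using assms by (metis card_image card_mono finite finite_orb not_le)
  then obtain e e' where e: "e \<in> E" "e' \<in> E" "e \<noteq> e'" "act (t e) f = act (t e') f"
    unfolding inj_on_def by blast
  obtain a b where ab: "e = {a, b}" "a \<noteq> b" "t e = Transposition.transpose a b" using bspec[OF t e(1)] by (elim exE conjE)
  obtain c d where cd: "e' = {c, d}" "c \<noteq> d" "t e' = Transposition.transpose c d" using bspec[OF t e(2)] by (elim exE conjE)
  show thesis using that[of a b c d] ab cd e(3,4) by simp
qed

text \<open>Transitivity after fixing no, one and two points amounts to 3-transitivity: the images
  of three points are corrected one after another.\<close>

lemma homogeneous_le_3: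
  fixes S S' :: "'v::finite set"
  assumes t0: "transitive_on UNIV f" and t1: "\<And>a. transitive_on (UNIV - {a}) f"
    and t2: "\<And>a b. a \<noteq> b \<Longrightarrow> transitive_on (UNIV - {a, b}) f"
    and eq: "card S = card S'" and le: "card S \<le> 3"
  shows "\<exists>u\<in>stab UNIV f. u ` S = S'"
proof -
  have s0: "\<exists>u\<in>stab UNIV f. u x = y" for x y using transitive_onE[OF t0, of x y] by blast
  have s1: "\<exists>u\<in>stab UNIV f. u a = a \<and> u x = y" if d: "x \<noteq> a" "y \<noteq> a" for a x y
  proof -
    obtain u where u: "u \<in> stab (UNIV - {a}) f" "u x = y" using d transitive_onE[OF t1[of a], of x y] by blast
    then have "u a = a" using stab_permutes[OF u(1)] by (simp add: permutes_def)
    then show ?thesis using u stab_UNIV[OF u(1)] by blast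
  qed
  have s2: "\<exists>u\<in>stab UNIV f. u a = a \<and> u b = b \<and> u x = y"
    if d: "x \<noteq> a" "y \<noteq> a" "x \<noteq> b" "y \<noteq> b" "a \<noteq> b" for a b x y
  proof -
    obtain u where u: "u \<in> stab (UNIV - {a, b}) f" "u x = y"
      using d transitive_onE[OF t2[of a b], of x y] by blast
    then have "u a = a" "u b = b" using stab_permutes[OF u(1)] by (simp_all add: permutes_def)
    then show ?thesis using u stab_UNIV[OF u(1)] by blast
  qed
  have r1: "\<exists>u\<in>stab UNIV f. u x = x' \<and> u y = y'" if d: "x \<noteq> y" "x' \<noteq> y'" for x y x' y'
  proof -
    obtain u where u: "u \<in> stab UNIV f" "u x = x'" using s0 by blast
    have "u y \<noteq> x'" using u d by (metis bij_is_inj injD stab_UNIV_iff)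
    then obtain w where w: "w \<in> stab UNIV f" "w x' = x'" "w (u y) = y'" using s1[of "u y" x' y'] d by metis
    show ?thesis using stab_comp[OF w(1) u(1)] u(2) w by (intro bexI[of _ "w \<circ> u"]) simp_all
  qed
  have r2: "\<exists>u\<in>stab UNIV f. u x = x' \<and> u y = y' \<and> u z = z'"
    if d: "x \<noteq> y" "x \<noteq> z" "y \<noteq> z" "x' \<noteq> y'" "x' \<noteq> z'" "y' \<noteq> z'" for x y z x' y' z'
  proof -
    obtain u where u: "u \<in> stab UNIV f" "u x = x'" "u y = y'" using r1[of x y x' y'] d by blast
    have "u z \<noteq> x'" "u z \<noteq> y'" using u d by (metis bij_is_inj injD stab_UNIV_iff)+
    then obtain w where w: "w \<in> stab UNIV f" "w x' = x'" "w y' = y'" "w (u z) = z'"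
      using s2[of "u z" x' z' y'] d by metis
    show ?thesis using stab_comp[OF w(1) u(1)] u w by (intro bexI[of _ "w \<circ> u"]) simp_all
  qed
  consider "card S = 0" | "card S = 1" | "card S = 2" | "card S = 3" using le by linarith
  then show ?thesis
  proof cases
    case 1
    then have "S = {}" "S' = {}" using eq by simp_all
    then show ?thesis using stab_id by auto
  next
    case 2
    then obtain x x' where "S = {x}" "S' = {x'}" using eq by (metis card_1_singletonE)
    then show ?thesis using s0[of x x'] by auto
  next
    case 3
    then obtain x y x' y' where "S = {x, y}" "S' = {x', y'}" "x \<noteq> y" "x' \<noteq> y'"
      using eq by (metis card_2_iff)
    then show ?thesis using r1[of x y x' y'] by auto
  next
    case 4
    then obtain x y z x' y' z' where "S = {x, y, z}" "S' = {x', y', z'}" "x \<noteq> y" "x \<noteq> z" "y \<noteq> z"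
      "x' \<noteq> y'" "x' \<noteq> z'" "y' \<noteq> z'"
      using eq by (metis card_3_iff)
    then show ?thesis using r2[of x y z x' y' z'] by auto
  qed
qed

subsection \<open>Stabilisers of small index\<close>

text \<open>Two colliding transpositions must be disjoint, as overlapping ones would make distinct
  points exchangeable. With \<open>Z\<close> the complement of their four points, the stabiliser
  within \<open>insert a Z\<close> fixes \<open>a\<close>, so adding \<open>a\<close> multiplies the
  orbit by \<open>card Z + 1\<close>.\<close>

lemma no_exch_collision:
  fixes f :: "('v::finite \<Rightarrow> 'b) \<Rightarrow> 'c"
  assumes small: "card (orb UNIV f) < CARD('v) choose 2"
    and no: "\<And>p q. exch f p q \<Longrightarrow> p = q"
  shows "\<exists>Z::'v set. card Z + 4 = CARD('v) \<and> (card Z + 1) * card (orb Z f) \<le> card (orb UNIV f)"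
proof -
  let ?t = Transposition.transpose
  obtain a b c d where abcd: "a \<noteq> b" "c \<noteq> d" "{a, b} \<noteq> {c, d}"
    and eq: "act (?t a b) f = act (?t c d) f"
    using transpose_pair_collision[OF small] .
  have ne: "q = r" if "act (?t p q) f = act (?t p r) f" for p q r
    using no[OF exch_if_transpose_eq[OF that]] .
  have ac: "a \<noteq> c"
  proof
    assume "a = c"
    then have "b = d" using ne[of a b d] eq by simp
    then show False using \<open>a = c\<close> abcd by simp
  qed
  have ad: "a \<noteq> d"
  proof
    assume "a = d"
    then have "b = c" using ne[of a b c] eq transpose_commute[of c d] by simp
    then show False using \<open>a = d\<close> abcd by auto
  qed
  have bc: "b \<noteq> c"
  proof
    assume "b = c"
    then have "a = d" using ne[of b a d] eq transpose_commute[of a b] by simp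
    then show False using ad by simp
  qed
  have bd: "b \<noteq> d"
  proof
    assume "b = d"
    then have "a = c" using ne[of b a c] eq transpose_commute[of a b] transpose_commute[of c d] by simp
    then show False using ac by simp
  qed
  define Z where "Z = UNIV - {a, b, c, d}"
  have cZ: "card Z + 4 = CARD('v)"
  proof -
    have c4: "card {a, b, c, d} = 4" using abcd ac ad bc bd by simp
    then have "4 \<le> CARD('v)" using card_mono[of UNIV "{a, b, c, d}"] by simp
    then show ?thesis unfolding Z_def using c4 by (simp add: card_Diff_subset)
  qed
  have aZ: "a \<notin> Z" by (simp add: Z_def)
  have fix_a: "h a = a" if h: "h \<in> stab (insert a Z) f" for h
  proof -
    have per: "h permutes insert a Z" using h by (rule stab_permutes)
    have bij: "bij h" using per by (rule permutes_bij)
    have fx: "h b = b" "h c = c" "h d = d"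
      using per abcd ac ad by (auto simp: permutes_def Z_def)
    \<comment> \<open>Conjugation by \<open>h\<close> turns the transposition of \<open>x\<close>
      and \<open>y\<close> into that of their images. As \<open>h\<close> fixes \<open>b\<close>,
      \<open>c\<close>, \<open>d\<close>, the collision passes from \<open>a\<close> to
      \<open>h a\<close>.\<close>
    have conj: "act (?t (h x) (h y)) f = act h (act (?t x y) f)" for x y
    proof -
      have "act (?t (h x) (h y)) f = act (?t (h x) (h y)) (act h f)"
        using h by (simp add: stab_act)
      also have "\<dots> = act (?t (h x) (h y) \<circ> h) f" by (simp add: act_comp)
      also have "?t (h x) (h y) \<circ> h = h \<circ> ?t x y"
        using bij by (simp add: transpose_comp_eq bij_is_inj)
      finally show ?thesis unfolding act_comp .
    qed
    have "act (?t (h a) b) f = act h (act (?t a b) f)" using conj[of a b] fx by simp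
    also have "\<dots> = act h (act (?t c d) f)" by (simp only: eq)
    also have "\<dots> = act (?t c d) f" using conj[of c d] fx by simp
    also have "\<dots> = act (?t a b) f" by (simp only: eq)
    finally have "act (?t b (h a)) f = act (?t b a) f" by (simp add: transpose_commute[of b])
    then show "h a = a" by (rule ne)
  qed
  have "card (orb (insert a Z) f) = card (insert a Z) * card (orb (insert a Z - {a}) f)"
    using fix_a by (intro card_orb_fixed) auto
  also have "\<dots> = (card Z + 1) * card (orb Z f)" using aZ by simp
  finally have "(card Z + 1) * card (orb Z f) \<le> card (orb UNIV f)"
    using card_mono[OF finite_orb[of UNIV f] orb_mono[of "insert a Z" UNIV f]] by simp
  then show ?thesis using cZ by blast
qed

text \<open>Fixing \<open>a\<close> keeps the orbit size; intransitivity then gives a second fixed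
  point \<open>b\<close> and divides that size by \<open>CARD('v) - 1\<close>. The remaining points
  become mutually exchangeable, and transitivity spreads this to all points.\<close>

lemma transitive_small_orb_exch:
  fixes f :: "('v::finite \<Rightarrow> 'b) \<Rightarrow> 'c"
  assumes n: "6 \<le> CARD('v)" and small: "2 * card (orb UNIV f) < CARD('v) * (CARD('v) - 3)"
    and tr: "transitive_on UNIV f" and ntr: "\<not> transitive_on (UNIV - {a}) f"
  shows "exch f x y"
proof -
  \<comment> \<open>Writing \<open>CARD('v)\<close> as \<open>n + 6\<close> removes truncated
    subtraction from the estimates.\<close>
  define n where "n = CARD('v) - 6"
  have N: "CARD('v) = n + 6" using n by (simp add: n_def)
  have N3: "CARD('v) - 3 = n + 3" by (simp add: N)
  have cA: "card (UNIV - {a}) = n + 5" by (simp add: N)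
  have m1: "card (orb (UNIV - {a}) f) = card (orb UNIV f)" using tr by (simp add: card_orb_trans)
  have "2 * ((n + 5) choose 2) = (n + 5) * (n + 4)" by (simp add: choose_two)
  moreover have "2 * card (orb UNIV f) < (n + 6) * (n + 3)" using small unfolding N3 unfolding N .
  moreover have "(n + 6) * (n + 3) < (n + 5) * (n + 4)" by (simp add: algebra_simps)
  ultimately have "card (orb (UNIV - {a}) f) < card (UNIV - {a}) choose 2" unfolding m1 cA by linarith
  then obtain b where b: "b \<in> UNIV - {a}" "\<And>u. u \<in> stab (UNIV - {a}) f \<Longrightarrow> u b = b"
    using fixed_point_of_small_orb[OF ntr] by blast
  define W where "W = UNIV - {a} - {b}"
  have "card (orb UNIV f) = (n + 5) * card (orb W f)"
    unfolding W_def cA[symmetric] m1[symmetric] by (rule card_orb_fixed[OF b(1)]) (rule b(2))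
  then have "(n + 5) * (2 * card (orb W f)) < (n + 6) * (n + 3)" using small unfolding N3 unfolding N by simp
  also have "\<dots> \<le> (n + 5) * (n + 4)" by (simp add: algebra_simps)
  finally have "2 * card (orb W f) < n + 4" by (simp only: nat_mult_less_cancel_disj)
  moreover have cW: "card W = n + 4" using b(1) by (simp add: W_def N)
  ultimately have W: "exch f p q" if "p \<in> W" "q \<in> W" for p q
    using exch_all_of_small_orb[of W f] that by simp
  obtain w where w: "w \<in> W" using cW by fastforce
  have w_all: "exch f w z" for z
  proof -
    obtain u where u: "u \<in> stab UNIV f" "u w = z" using transitive_onE[OF tr, of w z] by blast
    have inj: "inj u" using u(1) by (simp add: stab_UNIV_iff bij_is_inj)
    \<comment> \<open>\<open>W\<close> omits only two points, so it is too large to be disjoint from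
      its image.\<close>
    have "u ` W \<inter> W \<noteq> {}"
    proof
      assume "u ` W \<inter> W = {}"
      then have "card (u ` W \<union> W) = 2 * (n + 4)"
        using cW inj by (simp add: card_Un_disjoint card_image inj_on_subset)
      moreover have "card (u ` W \<union> W) \<le> n + 6" using card_mono[of UNIV "u ` W \<union> W"] N by simp
      ultimately show False by simp
    qed
    then obtain v where v: "v \<in> W" "u v \<in> W" by blast
    have "exch f (u w) (u v)" by (rule exch_stab[OF W[OF w v(1)] u(1)])
    then show ?thesis using exch_trans[OF W[OF w v(2)] exch_sym] u(2) by simp
  qed
  show ?thesis by (rule exch_trans[OF exch_sym[OF w_all] w_all])
qed

text \<open>For six points the exceptional subgroup \<open>PGL(2, 5)\<close> of index 6 survives the counting
  arguments; it exchanges no two points in the sense of \<open>exch\<close>, but it is 3-transitive.\<close>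

lemma transitive_small_orb_6:
  fixes f :: "('v::finite \<Rightarrow> 'b) \<Rightarrow> 'c"
  assumes n: "CARD('v) = 6" and small: "card (orb UNIV f) \<le> 8"
    and t0: "transitive_on UNIV f" and t1: "\<And>a. transitive_on (UNIV - {a}) f"
    and no: "\<And>p q. exch f p q \<Longrightarrow> p = q" and ab: "a \<noteq> b"
  shows "transitive_on (UNIV - {a, b}) f"
proof (rule ccontr)
  assume ntr: "\<not> transitive_on (UNIV - {a, b}) f"
  define W where "W = UNIV - {a, b}"
  have cW: "card W = 4" using ab n by (simp add: W_def card_Diff_subset)
  have "W = UNIV - {a} - {b}" by (auto simp: W_def)
  then have "card (orb W f) = card (orb (UNIV - {a}) f)"
    using card_orb_trans[OF _ t1[of a], of b] ab by simp
  also have "\<dots> = card (orb UNIV f)" using t0 by (simp add: card_orb_trans)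
  finally have m: "card (orb W f) \<le> 8" using small by simp
  \<comment> \<open>Fixing \<open>c\<close> leaves three points and hence at least five functions.
    The double count gives 20 as a lower bound for at most 8 times the stabiliser orbit of
    \<open>c\<close>, so that orbit has at least three points.\<close>
  have big: "3 \<le> card ((\<lambda>u. u c) ` stab W f)" if c: "c \<in> W" for c
  proof -
    have "card (W - {c}) = 3" using c cW by simp
    then obtain x y z where xyz: "W - {c} = {x, y, z}" "x \<noteq> y" "x \<noteq> z" "y \<noteq> z"
      by (metis card_3_iff)
    have "5 \<le> card (orb (W - {c}) f)"
      by (rule five_le_card_orb[of x _ y z]) (use xyz no in auto)
    then have "20 \<le> card (orb W f) * card ((\<lambda>u. u c) ` stab W f)"
      using card_orb_remove[OF c, of f] cW by simp
    also have "\<dots> \<le> 8 * card ((\<lambda>u. u c) ` stab W f)" using m by simp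
    finally show ?thesis by simp
  qed
  obtain I where I: "I \<subset> W" "I \<noteq> {}" "\<And>u. u \<in> stab W f \<Longrightarrow> u ` I = I"
    using not_transitive_invariant[OF ntr[folded W_def]] by blast
  obtain c d where c: "c \<in> I" and d: "d \<in> W - I" using I by blast
  have 1: "(\<lambda>u. u c) ` stab W f \<subseteq> I" using I(3) c by blast
  have "u d \<in> W - I" if u: "u \<in> stab W f" for u
  proof -
    have "inj u" using stab_permutes[OF u] by (rule permutes_inj)
    then have "u d \<notin> I" using I(3)[OF u] d by (metis Diff_iff inj_image_mem_iff)
    then show ?thesis using d stab_permutes[OF u] by (simp add: permutes_in_image)
  qed
  then have 2: "(\<lambda>u. u d) ` stab W f \<subseteq> W - I" by blast
  \<comment> \<open>A set of four points cannot split into two invariant parts of at least three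
    points each.\<close>
  have "3 \<le> card I" using big[of c] c I(1) card_mono[OF _ 1] by fastforce
  moreover have "3 \<le> card (W - I)" using big[of d] d card_mono[OF _ 2] by fastforce
  moreover have "card (W - I) = card W - card I" using I(1) by (simp add: card_Diff_subset)
  ultimately show False using cW by simp
qed

text \<open>If some pair is not exchangeable, no two distinct points are. The collision bound then
  excludes all but six or seven points; seven falls to the bound of five on three points, and six is
  settled by 3-transitivity.\<close>

lemma transitive_small_orb_homogeneous:
  fixes f :: "('v::finite \<Rightarrow> 'b) \<Rightarrow> 'c"
  assumes n: "6 \<le> CARD('v)" and small: "2 * card (orb UNIV f) < CARD('v) * (CARD('v) - 3)"
    and tr: "transitive_on UNIV f" and eq: "card S = card S'"
  shows "\<exists>u\<in>stab UNIV f. u ` S = S'"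
proof (cases "\<forall>p q. exch f p q")
  case True
  then show ?thesis using homogeneous_of_exch[of UNIV f S S'] eq by blast
next
  case nall: False
  have t1: "transitive_on (UNIV - {a}) f" for a
    using transitive_small_orb_exch[OF n small tr] nall by blast
  have no: "p = q" if "exch f p q" for p q
    using exch_all_of_transitive[OF that _ UNIV_I UNIV_I t1 UNIV_I UNIV_I] nall by blast
  define n where "n = CARD('v) - 6"
  have N: "CARD('v) = n + 6" using n by (simp add: n_def)
  have N3: "CARD('v) - 3 = n + 3" by (simp add: N)
  have sm: "2 * card (orb UNIV f) < (n + 6) * (n + 3)" using small unfolding N3 unfolding N .
  have "2 * ((n + 6) choose 2) = (n + 6) * (n + 5)" by (simp add: choose_two)
  moreover have "(n + 6) * (n + 3) \<le> (n + 6) * (n + 5)" by (intro mult_le_mono2) simp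
  ultimately have "card (orb UNIV f) < CARD('v) choose 2" using sm unfolding N by linarith
  from no_exch_collision[OF this] no obtain Z :: "'v set" where
    Z: "card Z + 4 = CARD('v)" "(card Z + 1) * card (orb Z f) \<le> card (orb UNIV f)" by blast
  have cZ: "card Z = n + 2" using Z(1) N by simp
  have "(n + 3) * (2 * card (orb Z f)) \<le> 2 * card (orb UNIV f)" using Z(2) by (simp add: cZ algebra_simps)
  also have "\<dots> < (n + 3) * (n + 6)" using sm by (simp add: mult.commute)
  finally have o: "2 * card (orb Z f) < n + 6" by (simp only: nat_mult_less_cancel_disj)
  have "n + 2 \<le> card (orb Z f)"
  proof (rule ccontr)
    assume "\<not> n + 2 \<le> card (orb Z f)"
    then have "card (orb Z f) < card Z" using cZ by simp
    then obtain x y where "x \<noteq> y" "exch f x y" by (rule exch_of_small_orb)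
    then show False using no by blast
  qed
  then have "n < 2" using o by simp
  have "n \<noteq> 1"
  proof
    assume "n = 1"
    then have "card Z = 3" using cZ by simp
    then obtain x y z where xyz: "Z = {x, y, z}" "x \<noteq> y" "x \<noteq> z" "y \<noteq> z" by (metis card_3_iff)
    have "5 \<le> card (orb Z f)"
      by (rule five_le_card_orb[of x _ y z]) (use xyz no in auto)
    then show False using o \<open>n = 1\<close> by simp
  qed
  then have n0: "n = 0" using \<open>n < 2\<close> by simp
  have n6: "CARD('v) = 6" and le8: "card (orb UNIV f) \<le> 8" using N sm n0 by simp_all
  have hom: "\<exists>u\<in>stab UNIV f. u ` T = T'" if "card T = card T'" "card T \<le> 3" for T T'
    by (rule homogeneous_le_3[OF tr t1 _ that])
      (rule transitive_small_orb_6[OF n6 le8 tr t1 no])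
  show ?thesis
  proof (cases "card S \<le> 3")
    case True
    then show ?thesis using hom eq by blast
  next
    case False
    \<comment> \<open>Among six points, a set of more than three is handled through its
      complement.\<close>
    have "card (- S) = card (- S')" "card (- S) \<le> 3"
      using False eq n6 by (simp_all add: Compl_eq_Diff_UNIV card_Diff_subset)
    then obtain u where u: "u \<in> stab UNIV f" "u ` (- S) = - S'" using hom by blast
    then have "u ` S = S'" by (metis bij_image_Compl_eq double_complement stab_UNIV_iff)
    then show ?thesis using u(1) by blast
  qed
qed

subsection \<open>Counting component functions\<close>

definition bijs :: "('v::finite \<Rightarrow> nat) set" where
  "bijs = {\<sigma>. bij_betw \<sigma> UNIV {1..CARD('v)}}"

definition vertex :: "('v::finite \<Rightarrow> nat) \<Rightarrow> real ^ 'v" where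
  "vertex \<sigma> = (\<chi> v. real (\<sigma> v))"

lemma vertices_eq: "permutahedron_vertices = vertex ` bijs"
  by (auto simp: permutahedron_vertices_def vertex_def bijs_def)

lemma finite_bijs: "finite (bijs :: ('v::finite \<Rightarrow> nat) set)"
proof (rule finite_subset)
  show "(bijs :: ('v \<Rightarrow> nat) set) \<subseteq> (\<Pi>\<^sub>E v\<in>UNIV. {1..CARD('v)})"
    by (auto simp: bijs_def bij_betw_def PiE_def)
qed (simp add: finite_PiE)

lemma bijs_comp:
  fixes \<pi> :: "'v::finite \<Rightarrow> 'v"
  assumes "bij \<pi>"
  shows "\<sigma> \<circ> \<pi> \<in> bijs \<longleftrightarrow> \<sigma> \<in> bijs"
  unfolding bijs_def mem_Collect_eq
  using bij_betw_comp_iff[OF assms, of \<sigma> "{1..CARD('v)}"] by simp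

lemma bijs_inj: "\<sigma> \<in> bijs \<Longrightarrow> inj \<sigma>"
  by (simp add: bijs_def bij_betw_def)

lemma bijs_range: "\<sigma> \<in> bijs \<Longrightarrow> range \<sigma> = {1..CARD('v)}" for \<sigma> :: "'v::finite \<Rightarrow> nat"
  by (simp add: bijs_def bij_betw_def)

lemma bijs_in: "\<sigma> \<in> bijs \<Longrightarrow> \<sigma> v \<in> {1..CARD('v)}" for \<sigma> :: "'v::finite \<Rightarrow> nat"
  using bijs_range by blast

lemma card_vimage_bijs:
  fixes \<sigma> :: "'v::finite \<Rightarrow> nat"
  assumes "\<sigma> \<in> bijs" "T \<subseteq> {1..CARD('v)}"
  shows "card (\<sigma> -` T) = card T" "\<sigma> ` (\<sigma> -` T) = T"
proof -
  show im: "\<sigma> ` (\<sigma> -` T) = T" using bijs_range[OF assms(1)] assms(2) by (simp add: image_vimage_eq inf_absorb1)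
  have "card (\<sigma> ` (\<sigma> -` T)) = card (\<sigma> -` T)"
    by (rule card_image) (rule inj_on_subset[OF bijs_inj[OF assms(1)]], simp)
  then show "card (\<sigma> -` T) = card T" unfolding im by simp
qed

section \<open>Stabilisers and supports under relabelling of points\<close>

lemma stab_value: "u \<in> stab UNIV f \<Longrightarrow> f (\<sigma> \<circ> u) = f \<sigma>"
  by (metis act_def stab_act)

lemma act_stab_conj:
  assumes "bij \<pi>" "u \<in> stab UNIV (act \<pi> f)"
  shows "inv \<pi> \<circ> (u \<circ> \<pi>) \<in> stab UNIV f"
  using assms act_inv_cancel[OF assms(1), of f]
  by (simp add: stab_UNIV_iff act_comp bij_comp bij_imp_bij_inv del: comp_apply)

lemma transitive_act:
  assumes \<pi>: "bij \<pi>" and tr: "transitive_on UNIV (act \<pi> f)"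
  shows "transitive_on UNIV f"
  unfolding transitive_on_def
proof (intro ballI)
  fix x y
  obtain u where u: "u \<in> stab UNIV (act \<pi> f)" "u (\<pi> x) = \<pi> y"
    using transitive_onE[OF tr, of "\<pi> x" "\<pi> y"] by blast
  have "(inv \<pi> \<circ> (u \<circ> \<pi>)) x = y" using u(2) \<pi> by (simp add: bij_is_inj)
  then show "\<exists>u\<in>stab UNIV f. u x = y" using act_stab_conj[OF \<pi> u(1)] by (rule rev_bexI[rotated])
qed

text \<open>The extreme elements of this set will tell for which \<open>k\<close> the function
  separates.\<close>

definition supp_at :: "(('v \<Rightarrow> nat) \<Rightarrow> real) \<Rightarrow> 'v \<Rightarrow> nat set" where
  "supp_at f v = {\<sigma> v |\<sigma>. f \<sigma> \<noteq> 0}"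

definition fixes_pt :: "(('v \<Rightarrow> nat) \<Rightarrow> real) \<Rightarrow> 'v \<Rightarrow> bool" where
  "fixes_pt f v \<longleftrightarrow> (\<forall>u\<in>stab UNIV f. u v = v)"

lemma fixes_pt_act:
  assumes \<pi>: "bij \<pi>" and f: "fixes_pt f v"
  shows "fixes_pt (act \<pi> f) (\<pi> v)"
  unfolding fixes_pt_def
proof
  fix u assume "u \<in> stab UNIV (act \<pi> f)"
  then have "(inv \<pi> \<circ> (u \<circ> \<pi>)) v = v" using act_stab_conj[OF \<pi>] f unfolding fixes_pt_def by blast
  then show "u (\<pi> v) = \<pi> v" using \<pi> by (metis bij_inv_eq_iff comp_apply)
qed

lemma supp_at_act:
  assumes \<pi>: "bij \<pi>" shows "supp_at (act \<pi> f) (\<pi> v) = supp_at f v"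
proof (intro equalityI subsetI)
  fix i assume "i \<in> supp_at (act \<pi> f) (\<pi> v)"
  then obtain \<sigma> where "i = (\<sigma> \<circ> \<pi>) v" "f (\<sigma> \<circ> \<pi>) \<noteq> 0" by (auto simp: supp_at_def act_def)
  then show "i \<in> supp_at f v" unfolding supp_at_def by blast
next
  fix i assume "i \<in> supp_at f v"
  then obtain \<sigma> where s: "i = \<sigma> v" "f \<sigma> \<noteq> 0" by (auto simp: supp_at_def)
  have "\<sigma> \<circ> inv \<pi> \<circ> \<pi> = \<sigma>" using \<pi> by (simp add: comp_assoc bij_is_inj)
  then have "act \<pi> f (\<sigma> \<circ> inv \<pi>) \<noteq> 0" using s by (simp add: act_def)
  moreover have "i = (\<sigma> \<circ> inv \<pi>) (\<pi> v)" using s \<pi> by (simp add: bij_is_inj)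
  ultimately show "i \<in> supp_at (act \<pi> f) (\<pi> v)" unfolding supp_at_def by blast
qed

text \<open>The combinatorial half of the argument: \<open>C\<close> stands for the coordinate
  functions of a section, and \<open>sep\<close> is what the geometry supplies. Assuming the bound
  fails makes every orbit in \<open>C\<close> small.\<close>

lemma card_component_functions:
  fixes C :: "(('v::finite \<Rightarrow> nat) \<Rightarrow> real) set"
  assumes fin: "finite C" and n: "6 \<le> CARD('v)"
    and closed: "\<And>f \<pi>. f \<in> C \<Longrightarrow> bij \<pi> \<Longrightarrow> act \<pi> f \<in> C"
    and dom: "\<And>f \<sigma>. f \<in> C \<Longrightarrow> f \<sigma> \<noteq> 0 \<Longrightarrow> \<sigma> \<in> bijs"
    and sep: "\<And>S \<rho>. \<rho> \<in> bijs \<Longrightarrow> S \<noteq> {} \<Longrightarrow> \<rho> ` S = insert (Suc (card S)) {1..<card S} \<Longrightarrow>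
      \<exists>f\<in>C. f \<rho> \<noteq> 0 \<and> (\<forall>\<sigma>\<in>bijs. \<sigma> ` S = {1..card S} \<longrightarrow> f \<sigma> = 0)"
  shows "CARD('v) * (CARD('v) - 1) \<le> 2 * card C"
proof (rule ccontr)
  let ?n = "CARD('v)"
  assume "\<not> ?n * (?n - 1) \<le> 2 * card C"
  then have less: "2 * card C < ?n * (?n - 1)" by simp
  have orb_C: "orb UNIV f \<subseteq> C" if "f \<in> C" for f
    using closed[OF that] by (auto simp: orb_def permutes_bij)
  have small: "2 * card (orb UNIV f) < ?n * (?n - 1)" if "f \<in> C" for f
    using card_mono[OF fin orb_C[OF that]] less by simp
  \<comment> \<open>Otherwise \<open>\<sigma> \<circ> u\<close> would map \<open>S\<close> onto
    \<open>{1..card S}\<close>, where \<open>f\<close> vanishes, although \<open>f\<close> takes the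
    same nonzero value there as at \<open>\<sigma>\<close>.\<close>
  have kill: "u ` S \<noteq> \<sigma> -` {1..card S}"
    if f: "f \<in> C" "f \<sigma> \<noteq> 0" "\<forall>\<sigma>\<in>bijs. \<sigma> ` S = {1..card S} \<longrightarrow> f \<sigma> = 0" and u: "u \<in> stab UNIV f"
    for f S \<sigma> u
  proof
    assume "u ` S = \<sigma> -` {1..card S}"
    then have "(\<sigma> \<circ> u) ` S = \<sigma> ` (\<sigma> -` {1..card S})" by (simp only: image_comp[symmetric])
    also have "\<dots> = {1..card S}"
      by (rule card_vimage_bijs(2)[OF dom[OF f(1,2)]]) (simp add: card_mono)
    finally have "f (\<sigma> \<circ> u) = 0"
      using f(3) dom[OF f(1,2)] u bijs_comp[of u \<sigma>] by (simp add: stab_UNIV_iff)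
    then show False using stab_value[OF u, of \<sigma>] f(2) by simp
  qed
  obtain \<beta> :: "'v \<Rightarrow> nat" where "bij_betw \<beta> UNIV {1..?n}"
    using finite_same_card_bij[of "UNIV :: 'v set" "{1..?n}"] by auto
  then have \<beta>: "\<beta> \<in> bijs" by (simp add: bijs_def)
  \<comment> \<open>Chosen so that the one bijection \<open>\<beta>\<close> is adjacent to the facet
    of \<open>S k\<close> for every \<open>k\<close>.\<close>
  define S where "S k = \<beta> -` insert (Suc k) {1..<k}" for k
  have S: "card (S k) = k" "\<beta> ` S k = insert (Suc (card (S k))) {1..<card (S k)}" "S k \<noteq> {}"
    if k: "k \<in> {1..<?n}" for k
  proof -
    have sub: "insert (Suc k) {1..<k} \<subseteq> {1..?n}" using k by auto
    show c: "card (S k) = k" unfolding S_def card_vimage_bijs(1)[OF \<beta> sub] using k by simp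
    show "\<beta> ` S k = insert (Suc (card (S k))) {1..<card (S k)}"
      unfolding c unfolding S_def by (rule card_vimage_bijs(2)[OF \<beta> sub])
    show "S k \<noteq> {}" using c k by auto
  qed
  have ex: "\<exists>f\<in>C. f \<beta> \<noteq> 0 \<and> (\<forall>\<sigma>\<in>bijs. \<sigma> ` S k = {1..card (S k)} \<longrightarrow> f \<sigma> = 0)"
    if "k \<in> {1..<?n}" for k
    by (rule sep[OF \<beta> S(3)[OF that] S(2)[OF that]])
  have card_fib: "card (\<sigma> -` {1..k}) = k" if "\<sigma> \<in> bijs" "k \<in> {1..<?n}" for \<sigma> :: "'v \<Rightarrow> nat" and k
    using card_vimage_bijs(1)[OF that(1), of "{1..k}"] that(2) by simp

  \<comment> \<open>For \<open>k = 1\<close> the set is a single point, so plain transitivity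
    already contradicts \<open>kill\<close>.\<close>
  obtain f0 where f0: "f0 \<in> C" "\<not> transitive_on UNIV f0"
  proof -
    have k: "1 \<in> {1..<?n}" using n by simp
    obtain f where f: "f \<in> C" "f \<beta> \<noteq> 0" "\<forall>\<sigma>\<in>bijs. \<sigma> ` S 1 = {1..card (S 1)} \<longrightarrow> f \<sigma> = 0"
      using ex[OF k] by blast
    obtain w where w: "S 1 = {w}" using S(1)[OF k] by (meson card_1_singletonE)
    obtain w' where w': "\<beta> -` {1..1} = {w'}" using card_fib[OF \<beta> k] by (meson card_1_singletonE)
    have "\<not> transitive_on UNIV f"
    proof
      assume "transitive_on UNIV f"
      then obtain u where u: "u \<in> stab UNIV f" "u w = w'" using transitive_onE[of UNIV f w w'] by blast
      then show False using kill[OF f u(1)] w w' by simp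
    qed
    then show thesis using that f(1) by blast
  qed
  \<comment> \<open>The orbits of \<open>f\<close> and \<open>f0\<close> are disjoint in
    \<open>C\<close>, and the latter has at least \<open>CARD('v)\<close> elements. This lowers the
    bound from \<open>n * (n - 1)\<close> to \<open>n * (n - 3)\<close>, where \<open>n\<close> is
    \<open>CARD('v)\<close>.\<close>
  have tr_small: "2 * card (orb UNIV f) < ?n * (?n - 3)" if f: "f \<in> C" "transitive_on UNIV f" for f
  proof -
    have "orb UNIV f \<inter> orb UNIV f0 = {}"
    proof (rule ccontr)
      assume "orb UNIV f \<inter> orb UNIV f0 \<noteq> {}"
      then obtain \<pi> \<pi>' where per: "\<pi> permutes UNIV" "\<pi>' permutes UNIV" and eq: "act \<pi> f = act \<pi>' f0"
        unfolding orb_def by auto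
      note \<pi> = permutes_bij[OF per(1)] permutes_bij[OF per(2)] eq
      have "f = act (inv \<pi> \<circ> \<pi>') f0"
        using act_inv_cancel[OF \<pi>(1), of f] \<pi>(3) by (simp add: act_comp del: comp_apply)
      moreover have "bij (inv \<pi> \<circ> \<pi>')" using \<pi> by (simp add: bij_comp bij_imp_bij_inv)
      ultimately show False using transitive_act[of "inv \<pi> \<circ> \<pi>'" f0] f(2) f0(2) by blast
    qed
    then have "card (orb UNIV f) + card (orb UNIV f0) = card (orb UNIV f \<union> orb UNIV f0)"
      by (simp add: card_Un_disjoint finite_orb)
    also have "\<dots> \<le> card C" by (rule card_mono[OF fin]) (use orb_C f(1) f0(1) in auto)
    finally have "card (orb UNIV f) + ?n \<le> card C" using card_le_card_orb[OF f0(2)] by simp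
    then have "2 * card (orb UNIV f) + 2 * ?n < ?n * (?n - 1)" using less by simp
    also have "?n * (?n - 1) = ?n * (?n - 3) + 2 * ?n" using n by (simp add: algebra_simps diff_mult_distrib2)
    finally show ?thesis by simp
  qed
  \<comment> \<open>Both describe a cut between \<open>k\<close> and \<open>k + 1\<close>: the
    support at \<open>v\<close> starts just above it (\<open>Mn\<close>) or ends just below it
    (\<open>Mx\<close>).\<close>
  define Mn where "Mn f v k \<longleftrightarrow> Suc k \<in> supp_at f v \<and> (\<forall>i\<in>supp_at f v. k < i)" for f :: "('v \<Rightarrow> nat) \<Rightarrow> real" and v k
  define Mx where "Mx f v k \<longleftrightarrow> k \<in> supp_at f v \<and> (\<forall>i\<in>supp_at f v. i \<le> k)" for f :: "('v \<Rightarrow> nat) \<Rightarrow> real" and v k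
  have some: "\<exists>f\<in>C. \<exists>v. fixes_pt f v \<and> (Mn f v k \<or> Mx f v k)" if k: "k \<in> {1..<?n}" for k
  proof -
    obtain f where f: "f \<in> C" "f \<beta> \<noteq> 0" "\<forall>\<sigma>\<in>bijs. \<sigma> ` S k = {1..card (S k)} \<longrightarrow> f \<sigma> = 0"
      using ex[OF k] by blast
    have "\<not> transitive_on UNIV f"
    proof
      assume tr: "transitive_on UNIV f"
      have "card (S k) = card (\<beta> -` {1..card (S k)})"
        using card_fib[OF \<beta> k] S(1)[OF k] by simp
      from transitive_small_orb_homogeneous[OF n tr_small[OF f(1) tr] tr this]
      obtain u where "u \<in> stab UNIV f" "u ` S k = \<beta> -` {1..card (S k)}" by blast
      then show False using kill[OF f] by blast
    qed
    then obtain v where v: "\<And>u. u \<in> stab UNIV f \<Longrightarrow> u v = v"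
      and exch_v: "\<And>x y. x \<noteq> v \<Longrightarrow> y \<noteq> v \<Longrightarrow> exch f x y"
      using intransitive_small_orb[OF small[OF f(1)]] by blast
    \<comment> \<open>If this failed, \<open>v\<close> would lie in both \<open>S k\<close> and the
      preimage of \<open>{1..k}\<close> or in neither; exchanges among the other points would then
      carry one set to the other.\<close>
    have key: "v \<in> S k \<longleftrightarrow> k < \<sigma> v" if \<sigma>: "f \<sigma> \<noteq> 0" for \<sigma>
    proof (rule ccontr)
      assume neq: "(v \<in> S k) \<noteq> (k < \<sigma> v)"
      have b: "\<sigma> \<in> bijs" using dom[OF f(1) \<sigma>] .
      let ?T = "\<sigma> -` {1..card (S k)}"
      have "v \<in> S k \<longleftrightarrow> v \<in> ?T" using neq bijs_in[OF b, of v] S(1)[OF k] by auto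
      moreover have "card (S k) = card ?T" using card_fib[OF b k] S(1)[OF k] by simp
      moreover have "exch f x y" if "x \<in> - {v}" "y \<in> - {v}" for x y using exch_v that by simp
      ultimately have "\<exists>u\<in>stab UNIV f. u ` S k = ?T"
        by (intro homogeneous_of_exch[of "- {v}"]) auto
      then show False using kill[OF f(1) \<sigma> f(3)] by blast
    qed
    have img: "\<beta> v \<in> insert (Suc k) {1..<k} \<longleftrightarrow> v \<in> S k" by (simp add: S_def)
    have in_supp: "\<beta> v \<in> supp_at f v" using f(2) unfolding supp_at_def by blast
    have "Mn f v k \<or> Mx f v k"
    proof (cases "v \<in> S k")
      case True
      then have "\<forall>i\<in>supp_at f v. k < i" using key unfolding supp_at_def by blast
      \<comment> \<open>Among the values of \<open>\<beta>\<close> on \<open>S k\<close> only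
        \<open>Suc k\<close> exceeds \<open>k\<close>; in the other case below, \<open>k\<close> is
        the only value up to \<open>k\<close> that is taken outside \<open>S k\<close>.\<close>
      moreover have "\<beta> v = Suc k" using img True key[OF f(2)] by auto
      ultimately show ?thesis using in_supp unfolding Mn_def by simp
    next
      case False
      then have "\<forall>i\<in>supp_at f v. i \<le> k" using key unfolding supp_at_def by (auto simp: not_less)
      moreover have "\<beta> v = k" using img False key[OF f(2)] bijs_in[OF \<beta>, of v] by auto
      ultimately show ?thesis using in_supp unfolding Mx_def by simp
    qed
    moreover have "fixes_pt f v" using v unfolding fixes_pt_def by blast
    ultimately show ?thesis using f(1) by blast
  qed
  have every: "\<exists>f. f \<in> C \<and> fixes_pt f v \<and> (Mn f v k \<or> Mx f v k)" if k: "k \<in> {1..<?n}" for k v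
  proof -
    obtain f w where f: "f \<in> C" "fixes_pt f w" "Mn f w k \<or> Mx f w k" using some[OF k] by blast
    define \<pi> where "\<pi> = Transposition.transpose w v"
    have \<pi>: "bij \<pi>" "\<pi> w = v" by (simp_all add: \<pi>_def)
    have "act \<pi> f \<in> C" using closed[OF f(1) \<pi>(1)] .
    moreover have "fixes_pt (act \<pi> f) v" using fixes_pt_act[OF \<pi>(1) f(2)] \<pi>(2) by simp
    moreover have "supp_at (act \<pi> f) v = supp_at f w" using supp_at_act[OF \<pi>(1), of f w] \<pi>(2) by simp
    then have "Mn (act \<pi> f) v k \<or> Mx (act \<pi> f) v k" using f(3) by (simp add: Mn_def Mx_def)
    ultimately show ?thesis by blast
  qed
  \<comment> \<open>Every point other than \<open>v0\<close> can be moved to a further point by an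
    exchange, so \<open>v0\<close> is the only fixed point.\<close>
  have unique: "v = v'" if f: "f \<in> C" "fixes_pt f v" "fixes_pt f v'" for f v v'
  proof -
    have other: "\<exists>y. y \<noteq> a \<and> y \<noteq> b" for a b :: 'v
    proof -
      have "card (UNIV - {a, b}) \<noteq> 0" using n card_insert_le_m1[of 2 "{b}" a] by (simp add: card_Diff_subset)
      then have "UNIV - {a, b} \<noteq> {}" by (metis card.empty)
      then show ?thesis by blast
    qed
    have "\<not> transitive_on UNIV f"
    proof
      assume "transitive_on UNIV f"
      moreover obtain y where y: "y \<noteq> v" using other by blast
      ultimately obtain u where "u \<in> stab UNIV f" "u v = y" using transitive_onE[of UNIV f v y] by blast
      then show False using f(2) y unfolding fixes_pt_def by blast
    qed
    then obtain v0 where "\<And>u. u \<in> stab UNIV f \<Longrightarrow> u v0 = v0" and v0: "\<And>x y. x \<noteq> v0 \<Longrightarrow> y \<noteq> v0 \<Longrightarrow> exch f x y"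
      using intransitive_small_orb[OF small[OF f(1)]] by blast
    have "w = v0" if w: "fixes_pt f w" for w
    proof (rule ccontr)
      assume ne: "w \<noteq> v0"
      obtain y where y: "y \<noteq> w" "y \<noteq> v0" using other by blast
      obtain u where "u \<in> stab UNIV f" "u w = y" using exch_imp_ex_stab[OF v0[OF ne y(2)]] by blast
      then show False using w y unfolding fixes_pt_def by blast
    qed
    then show ?thesis using f by blast
  qed
  define F where "F k v = (SOME f. f \<in> C \<and> fixes_pt f v \<and> (Mn f v k \<or> Mx f v k))" for k v
  have F: "F k v \<in> C" "fixes_pt (F k v) v" "Mn (F k v) v k \<or> Mx (F k v) v k" if "k \<in> {1..<?n}" for k v
    using someI_ex[OF every[OF that, of v]] unfolding F_def by blast+
  \<comment> \<open>The function determines \<open>v\<close>, and the Boolean says whether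
    \<open>k\<close> is read off the minimum or the maximum of the support. Hence \<open>H\<close>
    is injective and each function serves at most two pairs.\<close>
  define H where "H = (\<lambda>(k, v). (F k v, Mn (F k v) v k))"
  have "inj_on H ({1..<?n} \<times> UNIV)"
  proof (rule inj_onI, clarify)
    fix k v k' v'
    assume k: "k \<in> {1..<?n}" and k': "k' \<in> {1..<?n}" and H: "H (k, v) = H (k', v')"
    have e: "F k v = F k' v'" "Mn (F k v) v k \<longleftrightarrow> Mn (F k' v') v' k'" using H unfolding H_def by auto
    have v: "v = v'" using unique[OF F(1,2)[OF k]] F(2)[OF k', of v'] e(1) by simp
    have "k = k'"
    proof (cases "Mn (F k v) v k")
      case True
      then have "Mn (F k v) v k" "Mn (F k v) v k'" using e v by simp_all
      then show ?thesis unfolding Mn_def by (metis less_Suc_eq_le le_antisym)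
    next
      case False
      then have "Mx (F k v) v k" "Mx (F k v) v k'" using F(3)[OF k, of v] F(3)[OF k', of v'] e v by auto
      then show ?thesis unfolding Mx_def by (metis le_antisym)
    qed
    then show "k = k' \<and> v = v'" using v by simp
  qed
  moreover have "H ` ({1..<?n} \<times> UNIV) \<subseteq> C \<times> UNIV" using F(1) by (auto simp: H_def)
  ultimately have "card ({1..<?n} \<times> (UNIV :: 'v set)) \<le> card (C \<times> (UNIV :: bool set))"
    using fin by (intro card_inj_on_le) auto
  then show False using less by (simp add: card_cartesian_product mult.commute)
qed

subsection \<open>Extensions of the permutahedron\<close>

text \<open>Induction on the largest element: it exceeds the number of the positive elements below
  it.\<close>

lemma sum_distinct_ge:
  fixes A :: "nat set"
  assumes "finite A" "0 \<notin> A"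
  shows "card A * (card A + 1) \<le> 2 * \<Sum>A"
  using assms
proof (induction rule: finite_linorder_max_induct)
  case (insert b A)
  have "A \<subseteq> {1..<b}" using insert by (auto simp: Suc_le_eq intro!: gr0I)
  then have "card A \<le> card {1..<b}" by (intro card_mono) auto
  moreover have "b \<noteq> 0" using insert.prems by auto
  ultimately have "card A + 1 \<le> b" by simp
  moreover have "b \<notin> A" using insert.hyps by blast
  ultimately show ?case using insert by simp
qed simp

lemma linear_coordinate_sum: "linear (\<lambda>x :: real ^ 'n::finite. \<Sum>v\<in>S. x $ v)"
  by (rule linearI) (simp_all add: sum.distrib sum_distrib_left)

lemma coordinate_sum_vertex:
  assumes "\<sigma> \<in> bijs"
  shows "(\<Sum>v\<in>S. vertex \<sigma> $ v) = real (\<Sum>(\<sigma> ` S))"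
proof -
  have "inj_on \<sigma> S" using bijs_inj[OF assms] by (rule inj_on_subset) simp
  then show ?thesis by (simp add: vertex_def sum.reindex)
qed

text \<open>The inequality defines a convex half-space, so it suffices to check vertices, where the
  coordinates over \<open>S\<close> are distinct positive integers.\<close>

lemma permutahedron_facet:
  fixes x :: "real ^ 'n::finite"
  assumes "x \<in> permutahedron"
  shows "real (card S * (card S + 1)) \<le> 2 * (\<Sum>v\<in>S. x $ v)"
proof -
  let ?g = "\<lambda>x :: real ^ 'n. \<Sum>v\<in>S. x $ v"
  let ?c = "real (card S * (card S + 1)) / 2"
  have "permutahedron \<subseteq> ?g -` {?c..}"
    unfolding permutahedron_def
  proof (rule hull_minimal)
    show "convex (?g -` {?c..})"
      by (intro convex_linear_vimage linear_coordinate_sum convex_real_interval)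
    show "permutahedron_vertices \<subseteq> ?g -` {?c..}"
    proof
      fix x :: "real ^ 'n" assume "x \<in> permutahedron_vertices"
      then obtain \<sigma> where \<sigma>: "\<sigma> \<in> bijs" "x = vertex \<sigma>" by (auto simp: vertices_eq)
      have "0 < \<sigma> v" for v using bijs_in[OF \<sigma>(1), of v] by simp
      then have "0 \<notin> \<sigma> ` S" by (metis imageE less_irrefl)
      then have "card (\<sigma> ` S) * (card (\<sigma> ` S) + 1) \<le> 2 * \<Sum>(\<sigma> ` S)"
        by (intro sum_distinct_ge) auto
      moreover have "card (\<sigma> ` S) = card S"
        by (rule card_image[OF inj_on_subset[OF bijs_inj[OF \<sigma>(1)] subset_UNIV]])
      ultimately have "card S * (card S + 1) \<le> 2 * \<Sum>(\<sigma> ` S)" by simp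
      then have "real (card S * (card S + 1)) \<le> real (2 * \<Sum>(\<sigma> ` S))" by (rule of_nat_mono)
      then show "x \<in> ?g -` {?c..}" using coordinate_sum_vertex[OF \<sigma>(1), of S] \<sigma>(2) by simp
    qed
  qed
  then show ?thesis using assms by auto
qed

text \<open>If every variable positive at \<open>\<rho>\<close> were positive somewhere on the face of \<open>S\<close>, one could move
  from the barycentre of the lifted face slightly away from \<open>s (vertex \<rho>)\<close> inside \<open>Q\<close>, and
  the image of that point would violate the facet inequality of \<open>S\<close>.\<close>

lemma separating_component:
  fixes Q :: "(real ^ 'd::finite) set" and p :: "real ^ 'd \<Rightarrow> real ^ 'n::finite"
  assumes ext: "is_subspace_extension Q p permutahedron"
    and sec: "is_section s Q p permutahedron_vertices"
    and \<rho>: "\<rho> \<in> bijs" and ne: "S \<noteq> {}"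
    and img: "\<rho> ` S = insert (Suc (card S)) {1..<card S}"
  shows "\<exists>j. s (vertex \<rho>) $ j \<noteq> 0 \<and> (\<forall>\<sigma>\<in>bijs. \<sigma> ` S = {1..card S} \<longrightarrow> s (vertex \<sigma>) $ j = 0)"
proof (rule ccontr)
  assume contra: "\<not> ?thesis"
  define k where "k = card S"
  have k: "0 < k" using ne by (simp add: k_def card_gt_0_iff)
  obtain A where Q: "polytope Q" "linear p" "p ` Q = permutahedron"
    and A: "affine A" "Q = A \<inter> {y. \<forall>j. 0 \<le> y $ j}"
    using ext unfolding is_subspace_extension_def is_extension_def by blast
  have s: "s (vertex \<sigma>) \<in> Q" "p (s (vertex \<sigma>)) = vertex \<sigma>" if "\<sigma> \<in> bijs" for \<sigma>
    using sec that unfolding is_section_def by (auto simp: vertices_eq)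
  have s_nonneg: "0 \<le> s (vertex \<sigma>) $ j" if "\<sigma> \<in> bijs" for \<sigma> j using s(1)[OF that] A(2) by auto
  define \<Phi> where "\<Phi> = {\<sigma> \<in> bijs. \<sigma> ` S = {1..k}}"
  have fin: "finite \<Phi>" by (rule finite_subset[OF _ finite_bijs]) (auto simp: \<Phi>_def)
  \<comment> \<open>Swapping the values \<open>k\<close> and \<open>k + 1\<close> moves
    \<open>\<rho>\<close> onto the face, which shows that \<open>\<Phi>\<close> is nonempty.\<close>
  define \<tau> where "\<tau> = Transposition.transpose k (Suc k)"
  have "\<tau> \<circ> \<rho> \<in> \<Phi>"
  proof -
    have "Suc k \<in> range \<rho>" using img by (auto simp: k_def)
    then have "Suc k \<le> CARD('n)" using bijs_range[OF \<rho>] by auto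
    then have "\<tau> permutes {1..CARD('n)}" unfolding \<tau>_def using k by (intro permutes_swap_id) auto
    then have "bij_betw (\<tau> \<circ> \<rho>) UNIV {1..CARD('n)}"
      using \<rho> unfolding bijs_def mem_Collect_eq by (intro bij_betw_trans) (auto simp: permutes_imp_bij)
    moreover have "(\<tau> \<circ> \<rho>) ` S = {1..k}"
    proof -
      have "(\<tau> \<circ> \<rho>) ` S = insert (\<tau> (Suc k)) (\<tau> ` {1..<k})"
        unfolding image_comp[symmetric] img k_def by simp
      also have "\<tau> (Suc k) = k" by (simp add: \<tau>_def)
      also have "\<tau> ` {1..<k} = id ` {1..<k}" by (rule image_cong) (simp_all add: \<tau>_def)
      also have "insert k (id ` {1..<k}) = {1..k}" using k by auto
      finally show ?thesis .
    qed
    ultimately show ?thesis by (simp add: \<Phi>_def bijs_def)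
  qed
  then have card_pos: "0 < card \<Phi>" using fin by (auto simp: card_gt_0_iff)
  define y1 where "y1 = s (vertex \<rho>)"
  define y0 where "y0 = (\<Sum>\<sigma>\<in>\<Phi>. (1 / card \<Phi>) *\<^sub>R s (vertex \<sigma>))"
  have y1: "y1 \<in> Q" using s(1)[OF \<rho>] by (simp add: y1_def)
  have y0: "y0 \<in> Q" unfolding y0_def
    by (rule convex_sum[OF fin polytope_imp_convex[OF Q(1)]]) (use s(1) card_pos in \<open>auto simp: \<Phi>_def\<close>)
  have y0_pos: "0 < y0 $ j" if j: "y1 $ j \<noteq> 0" for j
  proof -
    obtain \<sigma> where \<sigma>: "\<sigma> \<in> \<Phi>" "s (vertex \<sigma>) $ j \<noteq> 0"
      using contra j unfolding y1_def \<Phi>_def k_def by blast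
    have nn: "0 \<le> s (vertex \<sigma>') $ j" if "\<sigma>' \<in> \<Phi>" for \<sigma>' using s_nonneg that by (simp add: \<Phi>_def)
    have "0 < (\<Sum>\<sigma>\<in>\<Phi>. (1 / card \<Phi>) * s (vertex \<sigma>) $ j)"
    proof (rule sum_pos2[OF fin \<sigma>(1)])
      show "0 < (1 / card \<Phi>) * s (vertex \<sigma>) $ j" using nn[OF \<sigma>(1)] \<sigma>(2) card_pos by simp
    qed (use nn in simp)
    then show ?thesis by (simp add: y0_def)
  qed
  have "\<exists>e>0. e * y1 $ j \<le> y0 $ j" for j
  proof (cases "y1 $ j = 0")
    case True
    then show ?thesis using y0 A(2) by (intro exI[of _ 1]) auto
  next
    case False
    then have "0 < y1 $ j" using y1 A(2) by (metis (mono_tags, lifting) IntD2 antisym_conv2 mem_Collect_eq)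
    then show ?thesis using y0_pos[OF False] by (intro exI[of _ "y0 $ j / y1 $ j"]) simp
  qed
  then obtain e where e: "\<And>j. 0 < e j" "\<And>j. e j * y1 $ j \<le> y0 $ j" by metis
  define \<epsilon> where "\<epsilon> = Min (range e)"
  have \<epsilon>: "0 < \<epsilon>" using e(1) by (simp add: \<epsilon>_def)
  have \<epsilon>_le: "\<epsilon> * y1 $ j \<le> y0 $ j" for j
  proof -
    have "\<epsilon> \<le> e j" by (simp add: \<epsilon>_def)
    then have "\<epsilon> * y1 $ j \<le> e j * y1 $ j" using y1 A(2) by (intro mult_right_mono) auto
    then show ?thesis using e(2)[of j] by linarith
  qed
  \<comment> \<open>The coefficients sum to 1, so \<open>z\<close> stays in the affine space; the
    choice of \<open>\<epsilon>\<close> keeps it in the orthant.\<close>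
  define z where "z = (1 + \<epsilon>) *\<^sub>R y0 + (- \<epsilon>) *\<^sub>R y1"
  have "z \<in> A" unfolding z_def by (rule mem_affine[OF A(1)]) (use y0 y1 A(2) in auto)
  moreover have "0 \<le> z $ j" for j
  proof -
    have "0 \<le> \<epsilon> * y0 $ j" using \<epsilon> y0 A(2) by auto
    then show ?thesis using \<epsilon>_le[of j] by (simp add: z_def algebra_simps)
  qed
  ultimately have "p z \<in> permutahedron" using A(2) Q(3) by blast
  then have low: "real (k * (k + 1)) \<le> 2 * (\<Sum>v\<in>S. p z $ v)"
    unfolding k_def by (rule permutahedron_facet)
  define h where "h = (\<lambda>y. \<Sum>v\<in>S. p y $ v)"
  have "h = (\<lambda>x. \<Sum>v\<in>S. x $ v) \<circ> p" by (auto simp: h_def)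
  then have h: "linear h" using linear_compose[OF Q(2) linear_coordinate_sum[of S]] by simp
  have h_s: "h (s (vertex \<sigma>)) = real (\<Sum>(\<sigma> ` S))" if "\<sigma> \<in> bijs" for \<sigma>
    unfolding h_def s(2)[OF that] by (rule coordinate_sum_vertex[OF that])
  have "2 * \<Sum>{1..m} = m * (m + 1)" for m :: nat
    by (induction m) simp_all
  then have gauss: "2 * real (\<Sum>{1..k}) = real (k * (k + 1))"
    by (metis of_nat_mult of_nat_numeral)
  have "h y0 = (\<Sum>\<sigma>\<in>\<Phi>. (1 / card \<Phi>) * h (s (vertex \<sigma>)))"
    unfolding y0_def using h by (simp add: linear_sum linear_scale)
  also have "\<dots> = (\<Sum>\<sigma>\<in>\<Phi>. (1 / card \<Phi>) * real (\<Sum>{1..k}))"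
    by (rule sum.cong) (use h_s in \<open>auto simp: \<Phi>_def\<close>)
  also have "\<dots> = real (\<Sum>{1..k})" using card_pos by simp
  finally have h0: "h y0 = real (\<Sum>{1..k})" .
  \<comment> \<open>Replacing \<open>k\<close> by \<open>k + 1\<close> raises the sum over
    \<open>S\<close> by exactly 1, so moving away from \<open>y1\<close> lowers \<open>h\<close> by
    \<open>\<epsilon>\<close> below the facet value.\<close>
  have "\<Sum>(\<rho> ` S) = Suc k + \<Sum>{1..<k}" unfolding img k_def[symmetric] by simp
  moreover have "\<Sum>{1..k} = k + \<Sum>{1..<k}" using k by (simp add: sum.last_plus)
  ultimately have h1: "h y1 = h y0 + 1" unfolding y1_def h0 h_s[OF \<rho>] by simp
  have "h z = (1 + \<epsilon>) * h y0 - \<epsilon> * h y1"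
    unfolding z_def using h by (simp add: linear_add linear_scale linear_neg linear_diff)
  also have "\<dots> = h y0 - \<epsilon>" unfolding h1 by (simp add: algebra_simps)
  finally have "2 * h z < real (k * (k + 1))" using h0 gauss \<epsilon> by simp
  then show False using low by (simp add: h_def)
qed

theorem theorem3:
  fixes Q :: "(real ^ 'd::finite) set"
    and p :: "real ^ 'd \<Rightarrow> real ^ 'n::finite"
  assumes "CARD('n) \<ge> 6"
    and "is_subspace_extension Q p permutahedron"
    and "weakly_symmetric Q p permutahedron_vertices {\<pi>::'n \<Rightarrow> 'n. bij \<pi>}"
  shows "CARD('d) \<ge> CARD('n) * (CARD('n) - 1) div 2"
proof -
  obtain s where sec: "is_section s Q p permutahedron_vertices"
    and sym: "\<And>\<pi> :: 'n \<Rightarrow> 'n. bij \<pi> \<Longrightarrow> \<exists>\<kappa> :: 'd \<Rightarrow> 'd. bij \<kappa> \<and>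
      (\<forall>x\<in>permutahedron_vertices. s (perm_act \<pi> x) = perm_act \<kappa> (s x))"
    using assms(3) unfolding weakly_symmetric_def by blast
  \<comment> \<open>The default 0 off \<open>bijs\<close> makes each function determined by its
    values at the vertices, so equalities there become equalities of functions.\<close>
  define c where "c = (\<lambda>j \<sigma>. if \<sigma> \<in> bijs then s (vertex \<sigma>) $ j else 0)"
  have closed: "act \<pi> f \<in> range c" if f: "f \<in> range c" and \<pi>: "bij \<pi>" for f \<pi>
  proof -
    obtain j where j: "f = c j" using f by blast
    \<comment> \<open>Since \<open>perm_act\<close> permutes coordinates by the inverse,
      precomposition with \<open>\<pi>\<close> corresponds to acting by \<open>inv \<pi>\<close> on
      vertices.\<close>
    obtain \<kappa> :: "'d \<Rightarrow> 'd" where \<kappa>: "\<forall>x\<in>permutahedron_vertices. s (perm_act (inv \<pi>) x) = perm_act \<kappa> (s x)"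
      using sym[OF bij_imp_bij_inv[OF \<pi>]] by blast
    have "act \<pi> f \<sigma> = c (inv \<kappa> j) \<sigma>" for \<sigma>
    proof (cases "\<sigma> \<in> bijs")
      case True
      have "vertex (\<sigma> \<circ> \<pi>) = perm_act (inv \<pi>) (vertex \<sigma>)"
        using \<pi> by (simp add: vertex_def perm_act_def inv_inv_eq)
      then have "s (vertex (\<sigma> \<circ> \<pi>)) = perm_act \<kappa> (s (vertex \<sigma>))"
        using \<kappa> True by (simp add: vertices_eq)
      then show ?thesis using True bijs_comp[OF \<pi>, of \<sigma>] by (simp add: act_def j c_def perm_act_def)
    next
      case False
      then show ?thesis using bijs_comp[OF \<pi>, of \<sigma>] by (simp add: act_def j c_def)
    qed
    then have "act \<pi> f = c (inv \<kappa> j)" by (rule ext)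
    then show ?thesis by simp
  qed
  have "CARD('n) * (CARD('n) - 1) \<le> 2 * card (range c)"
  proof (rule card_component_functions)
    fix f \<sigma> assume "f \<in> range c" "f \<sigma> \<noteq> 0"
    then show "\<sigma> \<in> bijs" by (auto simp: c_def split: if_splits)
  next
    fix S and \<rho> :: "'n \<Rightarrow> nat"
    assume \<rho>: "\<rho> \<in> bijs" "S \<noteq> {}" "\<rho> ` S = insert (Suc (card S)) {1..<card S}"
    obtain j where "s (vertex \<rho>) $ j \<noteq> 0"
      "\<forall>\<sigma>\<in>bijs. \<sigma> ` S = {1..card S} \<longrightarrow> s (vertex \<sigma>) $ j = 0"
      using separating_component[OF assms(2) sec \<rho>] by blast
    then have "c j \<rho> \<noteq> 0 \<and> (\<forall>\<sigma>\<in>bijs. \<sigma> ` S = {1..card S} \<longrightarrow> c j \<sigma> = 0)"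
      using \<rho>(1) by (simp add: c_def)
    then show "\<exists>f\<in>range c. f \<rho> \<noteq> 0 \<and> (\<forall>\<sigma>\<in>bijs. \<sigma> ` S = {1..card S} \<longrightarrow> f \<sigma> = 0)" by blast
  qed (use assms(1) closed in auto)
  \<comment> \<open>Several coordinates may define the same function, hence only an
    inequality.\<close>
  also have "card (range c) \<le> CARD('d)" by (rule card_image_le) simp
  finally show ?thesis by simp
qed

end
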